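(* Let $d\in\{2,3\}$, $T>0$, $\lambda>0$, $D=[0,2]^d$, $\Omega=D\times[0,T]$. Let $u\in C^4(\overline D\times[0,T];\mathbb{R}^d)$ be the ($D$-periodic) solution of the Kuramoto-Sivashinsky equation $\partial_tu+(u\cdot\nabla)u+\lambda\Delta u+\Delta^2u=0$, let $u^*\in C^4(\overline D\times[0,T];\mathbb{R}^d)$ be the PINN-generated approximate solution, and put $\hat u=u^*-u$. Let $\mathcal{R}_{\mathrm{PDE}},\mathcal{R}_{sb}^1,\dots,\mathcal{R}_{sb}^4,\mathcal{R}_{tb}$ be the residuals of $u^*$ defined in the context. Then $$\|u^*-u\|_{L^2(\Omega)}^2\le C_3\big(T+C_2T^2e^{C_2T}\big),$$ where $$C_2=C_1\Big(\|\hat u\|_{L^\infty(D)}^2+\|u\|_{L^\infty(D)}^2+\|\nabla u\|_{L^2(D)}^2+1\Big)$$ (suprema over $t\in[0,T]$ being taken of these norms), $C_1>0$ is a constant arising from Young's inequality, and $$C_3=\|\mathcal{R}_{tb}\|_{L^2(D)}^2+C\|\mathcal{R}_{\mathrm{PDE}}\|_{L^2(\Omega)}+C\,|\partial D|^{1/2}\,T^{1/2}\sum_{i=1}^4\|\mathcal{R}_{sb}^i\|_{L^2(\partial D\times[0,T])},$$ with $C=C\big(\|u\|_{C^4(\Omega)},\|\hat u\|_{C^4(\Omega)}\big)$ a constant depending on $\|u\|_{C^4(\Omega)}$ and $\|\hat u\|_{C^4(\Omega)}$.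
   Context: $D=[0,2]^d$ is regarded as a periodic cell: $u$ and its derivatives take equal values at corresponding points of opposite faces. $n$ is the unit normal vector to $\partial D$, and for $x\in\partial D$ the symbol $x+2$ denotes the corresponding point on the opposite face (translation by the period $2$ in the coordinate direction of the face); $\partial_n$ is the derivative in the direction $n$. A PINN-generated solution $u^*$ is a neural network function $u_\theta:D\times[0,T]\to\mathbb{R}^d$ (composition of affine maps and a componentwise activation function) used as an approximation of $u$. Its residuals are $$\mathcal{R}_{\mathrm{PDE}}=u^*_t+(u^*\cdot\nabla)u^*+\lambda\Delta u^*+\Delta^2u^*\quad\text{on }D\times(0,T),$$ and on $\partial D\times(0,T)$, $$\mathcal{R}_{sb}^1=u^*(x)-u^*(x+2),\quad \mathcal{R}_{sb}^2=\partial_n\big(u^*(x)-u^*(x+2)\big),$$ $$\mathcal{R}_{sb}^3=\Delta u^*(x)-\Delta u^*(x+2),\quad \mathcal{R}_{sb}^4=\partial_n\big(\Delta u^*(x)-\Delta u^*(x+2)\big),$$ and $\mathcal{R}_{tb}=u^*(t=0)-u(t=0)$ on $D$. $|\partial D|$ denotes the surface measure of $\partial D$. *)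

theory Defs
  imports "HOL-Analysis.Analysis" "HOL-Probability.Essential_Supremum"
begin

section \<open>Functions of class \<open>C\<^sup>k\<close> on a closed box\<close>

text \<open>
  The partial derivative in direction \<open>b\<close> is taken within \<open>S\<close>: on a nondegenerate closed box it is
  the usual one in the interior and the one-sided one at boundary points.  At points of \<open>S\<close> it only
  depends on the values of \<open>f\<close> on \<open>S\<close>; outside \<open>S\<close> it has no meaning.
\<close>

definition partial ::
  "'a::euclidean_space set \<Rightarrow> 'a \<Rightarrow> ('a \<Rightarrow> 'b::real_normed_vector) \<Rightarrow> 'a \<Rightarrow> 'b" where
  "partial S b f = (\<lambda>z. vector_derivative (\<lambda>h. f (z + h *\<^sub>R b)) (at 0 within {h. z + h *\<^sub>R b \<in> S}))"

primrec Ck_on ::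
  "nat \<Rightarrow> 'a::euclidean_space set \<Rightarrow> ('a \<Rightarrow> 'b::real_normed_vector) \<Rightarrow> bool" where
  "Ck_on 0 S f \<longleftrightarrow> continuous_on S f"
| "Ck_on (Suc k) S f \<longleftrightarrow> continuous_on S f \<and>
     (\<forall>b\<in>Basis.
        (\<forall>z\<in>S. (\<lambda>h. f (z + h *\<^sub>R b)) differentiable (at 0 within {h. z + h *\<^sub>R b \<in> S})) \<and>
        Ck_on k S (partial S b f))"

text \<open>The list \<open>[b\<^sub>1, \<dots>, b\<^sub>m]\<close> encodes the derivative \<open>\<partial>\<^bsub>b\<^sub>1\<^esub> \<dots> \<partial>\<^bsub>b\<^sub>m\<^esub>\<close> of order \<open>m\<close>.\<close>

definition partials ::
  "'a::euclidean_space set \<Rightarrow> 'a list \<Rightarrow> ('a \<Rightarrow> 'b::real_normed_vector) \<Rightarrow> 'a \<Rightarrow> 'b" where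
  "partials S bs f = foldr (partial S) bs f"

definition multi_indices :: "nat \<Rightarrow> 'a::euclidean_space list set" where
  "multi_indices k = {bs. set bs \<subseteq> Basis \<and> length bs \<le> k}"

definition Ck_norm ::
  "nat \<Rightarrow> 'a::euclidean_space set \<Rightarrow> ('a \<Rightarrow> 'b::real_normed_vector) \<Rightarrow> real" where
  "Ck_norm k S f = (SUP (bs, z) \<in> multi_indices k \<times> S. norm (partials S bs f z))"


section \<open>Lebesgue norms\<close>

definition L2_norm :: "'a measure \<Rightarrow> ('a \<Rightarrow> 'b::real_normed_vector) \<Rightarrow> real" where
  "L2_norm M f = sqrt (\<integral>z. (norm (f z))\<^sup>2 \<partial>M)"

definition Linf_norm :: "'a measure \<Rightarrow> ('a \<Rightarrow> 'b::real_normed_vector) \<Rightarrow> real" where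
  "Linf_norm M f = real_of_ereal (esssup M (\<lambda>z. ereal (norm (f z))))"


section \<open>The periodic cell and its boundary\<close>

text \<open>A point of space-time is a pair \<open>(x, t)\<close>.\<close>

definition cell :: "(real^'d) set" where
  "cell = cbox 0 (\<chi> i. 2)"

definition cyl :: "real \<Rightarrow> ((real^'d) \<times> real) set" where
  "cyl T = cell \<times> {0..T}"

text \<open>
  The boundary of the cell is the union of the \<open>2d\<close> faces \<open>x\<^sub>i = s\<close> with \<open>s \<in> {0, 2}\<close>, which overlap
  only in null sets.  On the face \<open>(i, s)\<close> the outer unit normal is \<open>(s - 1) e\<^sub>i\<close>, and the
  corresponding point on the opposite face is \<open>x - 2 (s - 1) e\<^sub>i\<close>.  The surface measure of a face is
  the Lebesgue measure in the remaining \<open>d - 1\<close> coordinates.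
\<close>

definition face :: "'d \<Rightarrow> real \<Rightarrow> (real^'d) set" where
  "face i s = {x \<in> cell. x $ i = s}"

definition normal_vec :: "'d \<Rightarrow> real \<Rightarrow> real^'d" where
  "normal_vec i s = (s - 1) *\<^sub>R axis i 1"

definition opposite :: "'d \<Rightarrow> real \<Rightarrow> real^'d \<Rightarrow> real^'d" where
  "opposite i s x = x - 2 *\<^sub>R normal_vec i s"

definition face_measure :: "'d \<Rightarrow> real \<Rightarrow> (real^'d) measure" where
  "face_measure i s =
     distr (Pi\<^sub>M (UNIV - {i}) (\<lambda>_. restrict_space lborel {0..2})) (restrict_space borel (face i s))
       (\<lambda>y. \<chi> j. if j = i then s else y j)"

definition boundary_area :: "'d::finite itself \<Rightarrow> real" where
  "boundary_area _ = (\<Sum>i\<in>(UNIV::'d set). \<Sum>s\<in>{0, 2}. measure (face_measure i s) (face i s))"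

text \<open>
  A function on \<open>\<partial>D \<times> [0,T]\<close> that may involve the normal is given by its restrictions \<open>g i s\<close> to the
  pieces \<open>face i s \<times> {0..T}\<close>.
\<close>

definition L2_norm_boundary ::
  "real \<Rightarrow> ('d::finite \<Rightarrow> real \<Rightarrow> (real^'d) \<times> real \<Rightarrow> 'b::real_normed_vector) \<Rightarrow> real" where
  "L2_norm_boundary T g =
     sqrt (\<Sum>i\<in>UNIV. \<Sum>s\<in>{0, 2}.
       \<integral>z. (norm (g i s z))\<^sup>2 \<partial>(face_measure i s \<Otimes>\<^sub>M restrict_space lborel {0..T}))"


section \<open>The Kuramoto-Sivashinsky equation\<close>

type_synonym 'd field = "(real^'d) \<times> real \<Rightarrow> real^'d"

definition dx :: "real \<Rightarrow> 'd \<Rightarrow> 'd::finite field \<Rightarrow> 'd field" where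
  "dx T i f = partial (cyl T) (axis i 1, 0) f"

definition dt :: "real \<Rightarrow> 'd::finite field \<Rightarrow> 'd field" where
  "dt T f = partial (cyl T) (0, 1) f"

definition laplace :: "real \<Rightarrow> 'd::finite field \<Rightarrow> 'd field" where
  "laplace T f = (\<lambda>z. \<Sum>i\<in>UNIV. dx T i (dx T i f) z)"

definition grad :: "real \<Rightarrow> 'd::finite field \<Rightarrow> (real^'d) \<times> real \<Rightarrow> real^'d^'d" where
  "grad T f = (\<lambda>z. \<chi> i. dx T i f z)"

definition advect :: "real \<Rightarrow> 'd::finite field \<Rightarrow> 'd field \<Rightarrow> 'd field" where
  "advect T v f = (\<lambda>z. \<Sum>j\<in>UNIV. (v z $ j) *\<^sub>R dx T j f z)"

definition KS_operator :: "real \<Rightarrow> real \<Rightarrow> 'd::finite field \<Rightarrow> 'd field" where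
  "KS_operator lam T f =
     (\<lambda>z. dt T f z + advect T f f z + lam *\<^sub>R laplace T f z + laplace T (laplace T f) z)"

definition cell_periodic :: "real \<Rightarrow> 'd::finite field \<Rightarrow> bool" where
  "cell_periodic T f \<longleftrightarrow>
     (\<forall>bs\<in>multi_indices 4. \<forall>i. \<forall>s\<in>{0, 2}. \<forall>x\<in>face i s. \<forall>t\<in>{0..T}.
        partials (cyl T) bs f (x, t) = partials (cyl T) bs f (opposite i s x, t))"

definition KS_solution :: "real \<Rightarrow> real \<Rightarrow> 'd::finite field \<Rightarrow> bool" where
  "KS_solution lam T u \<longleftrightarrow>
     Ck_on 4 (cyl T) u \<and> cell_periodic T u \<and>
     (\<forall>x\<in>cell. \<forall>t\<in>{0<..<T}. KS_operator lam T u (x, t) = 0)"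


section \<open>Neural networks and residuals\<close>

text \<open>
  \<open>nn_layer \<sigma> m h\<close>: the map \<open>z \<mapsto> (h z 0, \<dots>, h z (m - 1))\<close> is a composition of affine maps, alternating
  with the componentwise activation \<open>\<sigma>\<close>, that ends with an affine map.
\<close>

inductive nn_layer ::
  "(real \<Rightarrow> real) \<Rightarrow> nat \<Rightarrow> ('a::real_inner \<Rightarrow> nat \<Rightarrow> real) \<Rightarrow> bool" for \<sigma> where
  input: "nn_layer \<sigma> m (\<lambda>z k. W k \<bullet> z + b k)"
| hidden: "nn_layer \<sigma> m h \<Longrightarrow> nn_layer \<sigma> m' (\<lambda>z k. (\<Sum>j<m. W k j * \<sigma> (h z j)) + b k)"

text \<open>The final linear map only moves the last affine layer from \<open>\<real>\<^sup>m\<close> to the type \<open>'b\<close>.\<close>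

definition neural_network ::
  "(real \<Rightarrow> real) \<Rightarrow> 'a::real_inner set \<Rightarrow> ('a \<Rightarrow> 'b::real_vector) \<Rightarrow> bool" where
  "neural_network \<sigma> S f \<longleftrightarrow>
     (\<exists>m h w. nn_layer \<sigma> m h \<and> (\<forall>z\<in>S. f z = (\<Sum>k<m. h z k *\<^sub>R w k)))"

definition R_PDE :: "real \<Rightarrow> real \<Rightarrow> 'd::finite field \<Rightarrow> 'd field" where
  "R_PDE lam T v = KS_operator lam T v"

definition R_tb :: "'d::finite field \<Rightarrow> 'd field \<Rightarrow> real^'d \<Rightarrow> real^'d" where
  "R_tb v u x = v (x, 0) - u (x, 0)"

text \<open>
  In \<open>\<partial>\<^sub>n (g(x) - g(x + 2))\<close> the direction \<open>n\<close> is the normal at \<open>x\<close> for both terms; it is \<open>(s - 1) e\<^sub>i\<close>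
  on the face \<open>(i, s)\<close>.
\<close>

definition dn :: "real \<Rightarrow> 'd \<Rightarrow> real \<Rightarrow> 'd::finite field \<Rightarrow> 'd field" where
  "dn T i s f = (\<lambda>z. \<Sum>j\<in>UNIV. (normal_vec i s $ j) *\<^sub>R dx T j f z)"

definition jump :: "'d \<Rightarrow> real \<Rightarrow> 'd::finite field \<Rightarrow> 'd field" where
  "jump i s g = (\<lambda>(x, t). g (x, t) - g (opposite i s x, t))"

definition R_sb1 :: "'d::finite field \<Rightarrow> 'd \<Rightarrow> real \<Rightarrow> 'd field" where
  "R_sb1 v i s = jump i s v"

definition R_sb2 :: "real \<Rightarrow> 'd::finite field \<Rightarrow> 'd \<Rightarrow> real \<Rightarrow> 'd field" where
  "R_sb2 T v i s = jump i s (dn T i s v)"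

definition R_sb3 :: "real \<Rightarrow> 'd::finite field \<Rightarrow> 'd \<Rightarrow> real \<Rightarrow> 'd field" where
  "R_sb3 T v i s = jump i s (laplace T v)"

definition R_sb4 :: "real \<Rightarrow> 'd::finite field \<Rightarrow> 'd \<Rightarrow> real \<Rightarrow> 'd field" where
  "R_sb4 T v i s = jump i s (dn T i s (laplace T v))"

end

theory Submission
  imports Defs
begin

text \<open>
  Testing the equation for \<open>v = u\<^sup>* - u\<close> with \<open>v\<close> and integrating by parts gives
  \<open>\<partial>\<^sub>t\<parallel>v\<parallel>\<^sup>2 \<le> C (sup|v|\<^sup>2 + sup|u|\<^sup>2 + 1) \<parallel>v\<parallel>\<^sup>2 + C' (\<integral>|R| + boundary terms)\<close>, where \<open>R\<close> is the PDE
  residual and the constants in front of the residuals come from pointwise bounds on \<open>u\<close>, \<open>v\<close> and the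
  derivatives of \<open>v\<close>. The advection terms are absorbed by \<open>\<parallel>\<nabla>v\<parallel>\<^sup>2 \<le> \<parallel>v\<parallel> \<parallel>\<Delta>v\<parallel> + boundary terms\<close>,
  and \<open>v \<bullet> (v \<bullet> \<nabla>)u\<close> is first integrated by parts, so that no Sobolev embedding is needed. Because
  \<open>u\<close> is periodic, all boundary terms only involve the jumps of \<open>u\<^sup>*\<close>, that is, its boundary
  residuals. Gronwall's inequality for \<open>t \<mapsto> \<integral>\<^sub>0\<^sup>t \<parallel>v\<parallel>\<^sup>2\<close> concludes.
\<close>

section \<open>Integration over the cell and its faces\<close>

text \<open>The residuals enter \<open>C3\<close> to the first power because each of them is paired
  with a pointwise bound on the other factor, of order up to three in space (normal derivatives of
  the Laplacian); these bounds form \<open>C\<close>. Young's inequality is kept for the terms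
  quadratic in \<open>v\<close>, whose rate may contain only suprema of \<open>u\<close> and
  \<open>v\<close>. The two kinds of bounds are therefore separate parameters throughout. The
  estimate closes because the bilaplacian supplies -2 times the squared norm of the Laplacian of
  \<open>v\<close>, while the advection terms (through the gradient) and the \<open>lam\<close> term
  spend 1/2 each. The formal obstacle is the boundary: \<open>face_measure\<close> comes from a
  product of d - 1 intervals in a function space, whereas Lebesgue measure lives on
  \<open>real^'d\<close>. Freezing one coordinate with \<open>upd\<close> turns a face integral into
  half an integral over the whole cell, and Green's formula, jumps and boundary norms are compared
  there. Derivatives at boundary points are one-sided and the equation is given only for 0 < t < T,
  so linearity of derivatives and the endpoints in time need their own arguments.\<close>

lemma mem_cell: "x \<in> cell \<longleftrightarrow> (\<forall>i. 0 \<le> x $ i \<and> x $ i \<le> 2)"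
  by (auto simp: cell_def mem_box_cart)

lemma compact_cell: "compact cell"
  by (simp add: cell_def)

text \<open>\<open>upd i 0 x\<close> and \<open>upd i 2 x\<close> are the ends of the chord through
  \<open>x\<close> in direction i, that is, a pair of corresponding points on opposite
  faces.\<close>

definition upd :: "'d \<Rightarrow> real \<Rightarrow> real^'d \<Rightarrow> real^'d" where
  "upd i s x = (\<chi> j. if j = i then s else x $ j)"

lemma upd_nth [simp]: "upd i s x $ j = (if j = i then s else x $ j)"
  by (simp add: upd_def)

lemma upd_in_cell: "x \<in> cell \<Longrightarrow> s \<in> {0..2} \<Longrightarrow> upd i s x \<in> cell"
  by (auto simp: mem_cell)

lemma upd_in_face: "x \<in> cell \<Longrightarrow> s \<in> {0..2} \<Longrightarrow> upd i s x \<in> face i s"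
  by (auto simp: face_def upd_in_cell)

lemma upd_alt: "upd i s x = x + (s - x $ i) *\<^sub>R axis i 1"
  by (simp add: vec_eq_iff axis_def)

lemma continuous_on_upd [continuous_intros]:
  "continuous_on A f \<Longrightarrow> continuous_on A g \<Longrightarrow> continuous_on A (\<lambda>z. upd i (f z) (g z))"
  unfolding upd_alt by (intro continuous_intros)

text \<open>The measure inside \<open>face_measure\<close>, the same for both faces orthogonal to
  axis i. Its points are functions on the remaining indices; \<open>glue\<close> puts the missing
  coordinate back.\<close>

definition slice_measure :: "'d::finite \<Rightarrow> ('d \<Rightarrow> real) measure" where
  "slice_measure i = Pi\<^sub>M (UNIV - {i}) (\<lambda>_. restrict_space lborel {0..2})"

definition glue :: "'d \<Rightarrow> real \<Rightarrow> ('d \<Rightarrow> real) \<Rightarrow> real^'d" where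
  "glue i s y = (\<chi> j. if j = i then s else y j)"

lemma upd_glue [simp]: "upd i r (glue i s y) = glue i r y"
  by (simp add: upd_def glue_def vec_eq_iff)

abbreviation "I02 \<equiv> restrict_space lborel {0..2::real}"

lemma finite_measure_interval: "finite_measure (restrict_space lborel {a..b::real})"
  by (rule finite_measureI) (simp add: emeasure_restrict_space space_restrict_space emeasure_lborel_Icc_eq)

lemma space_slice: "space (slice_measure i) = (UNIV - {i}) \<rightarrow>\<^sub>E {0..2}"
  by (simp add: slice_measure_def space_PiM space_restrict_space)

lemma glue_in_cell: "y \<in> space (slice_measure i) \<Longrightarrow> s \<in> {0..2} \<Longrightarrow> glue i s y \<in> cell"
  by (force simp: space_slice mem_cell glue_def PiE_iff)

lemma emeasure_slice:
  assumes "\<And>j. A j \<in> sets borel" "\<And>j. A j \<subseteq> {0..2}"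
  shows "emeasure (slice_measure i) (Pi\<^sub>E (UNIV - {i}) A) = (\<Prod>j\<in>UNIV-{i}. emeasure lborel (A j))"
proof -
  interpret product_sigma_finite "\<lambda>_::'a. I02"
    by (simp add: product_sigma_finite_def finite_measure.axioms(1) finite_measure_interval)
  show ?thesis
    unfolding slice_measure_def
    using assms by (subst emeasure_PiM) (auto simp: emeasure_restrict_space sets_restrict_space_iff intro!: prod.cong)
qed

lemma finite_measure_slice: "finite_measure (slice_measure i)"
proof (rule finite_measureI)
  have "emeasure (slice_measure i) (space (slice_measure i)) = (\<Prod>j\<in>UNIV-{i}. emeasure lborel {0..2::real})"
    unfolding space_slice by (rule emeasure_slice) auto
  also have "\<dots> \<noteq> \<infinity>" by (simp add: power_eq_top_ennreal)
  finally show "emeasure (slice_measure i) (space (slice_measure i)) \<noteq> \<infinity>" .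
qed

lemma measure_slice: "measure (slice_measure (i::'d::finite)) (space (slice_measure i)) = 2 ^ (CARD('d) - 1)"
proof -
  have "emeasure (slice_measure i) (space (slice_measure i)) = (\<Prod>j\<in>UNIV-{i}. emeasure lborel {0..2::real})"
    unfolding space_slice by (rule emeasure_slice) auto
  also have "\<dots> = ennreal (2 ^ (CARD('d) - 1))" by (simp add: ennreal_power[symmetric])
  finally show ?thesis by (simp add: measure_def)
qed

text \<open>Checked coordinatewise: coordinate i is \<open>fst z\<close>, and each other one is a
  component projection of the product measure.\<close>

lemma measurable_glue:
  "(\<lambda>z. glue i (fst z) (snd z)) \<in> borel_measurable (I02 \<Otimes>\<^sub>M slice_measure i)"
proof (subst borel_measurable_euclidean_space, rule ballI)
  fix b :: "real^'a" assume "b \<in> Basis"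
  then obtain j where b: "b = axis j 1" by (auto simp: Basis_vec_def)
  have "(\<lambda>z. snd z j) \<in> borel_measurable (I02 \<Otimes>\<^sub>M slice_measure i)" if "j \<noteq> i"
  proof -
    have "(\<lambda>y. y j) \<in> measurable (slice_measure i) I02"
      unfolding slice_measure_def using that by (intro measurable_component_singleton) auto
    then have "(\<lambda>y. y j) \<in> borel_measurable (slice_measure i)"
      by (simp add: measurable_restrict_space2_iff)
    then show ?thesis by measurable
  qed
  moreover have "fst \<in> borel_measurable (I02 \<Otimes>\<^sub>M slice_measure i)"
    using measurable_fst[of I02 "slice_measure i"] by (simp add: measurable_restrict_space2_iff)
  ultimately show "(\<lambda>z. glue i (fst z) (snd z) \<bullet> b) \<in> borel_measurable (I02 \<Otimes>\<^sub>M slice_measure i)"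
    by (cases "j = i") (simp_all add: b inner_axis glue_def)
qed

text \<open>Empty boxes are included because a test box need not meet the cell in
  \<open>cell_measure_eq\<close>; then one factor is an empty interval and the product
  vanishes.\<close>

lemma emeasure_lborel_cbox_cart:
  fixes a b :: "real^'d"
  shows "emeasure lborel (cbox a b) = (\<Prod>i\<in>UNIV. emeasure lborel {a $ i .. b $ i})"
proof (cases "cbox a b = {}")
  case True
  then obtain i where "b $ i < a $ i" by (auto simp: interval_ne_empty_cart not_le interval_eq_empty_cart)
  then have "(\<Prod>i\<in>UNIV. emeasure lborel {a $ i .. b $ i}) = 0"
    by (intro prod_zero bexI[of _ i]) auto
  with True show ?thesis by simp
next
  case False
  then have le: "a $ i \<le> b $ i" for i by (simp add: interval_ne_empty_cart)
  have "emeasure lborel (cbox a b) = ennreal (measure lborel (cbox a b))"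
    by (rule emeasure_eq_ennreal_measure) (simp add: emeasure_lborel_cbox_eq)
  also have "measure lborel (cbox a b) = (\<Prod>i\<in>UNIV. b $ i - a $ i)"
    using content_cbox_cart[OF False] by simp
  also have "ennreal \<dots> = (\<Prod>i\<in>UNIV. ennreal (b $ i - a $ i))"
    using le by (subst prod_ennreal) auto
  also have "\<dots> = (\<Prod>i\<in>UNIV. emeasure lborel {a $ i .. b $ i})"
    using le by (simp add: emeasure_lborel_Icc_eq)
  finally show ?thesis .
qed

text \<open>Basis of all Fubini arguments below. Both measures agree on boxes, an
  intersection-stable generator of the Borel sets. The left side is a density rather than a
  restricted space so that both are measures on all of \<open>real^'d\<close>.\<close>

lemma cell_measure_eq:
  fixes i :: "'d::finite"
  shows "density lborel (indicator cell) =
    distr (I02 \<Otimes>\<^sub>M slice_measure i) borel (\<lambda>z. glue i (fst z) (snd z))" (is "?M = ?N")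
proof (rule measure_eqI_generator_eq)
  let ?E = "range (\<lambda>(a,b). {a..b} :: (real^'d) set)"
  interpret S: finite_measure "slice_measure i" by (rule finite_measure_slice)
  show "Int_stable ?E" by (auto simp: Int_stable_def interval_cbox_cart Int_interval)
  show "?E \<subseteq> Pow UNIV" by simp
  show "sets ?M = sigma_sets UNIV ?E" "sets ?N = sigma_sets UNIV ?E"
    by (simp_all, (subst borel_eq_atLeastAtMost, simp)+)
  show "range (\<lambda>n. {- real n *\<^sub>R (1::real^'d) .. real n *\<^sub>R 1}) \<subseteq> ?E" by auto
  show "(\<Union>n. {- real n *\<^sub>R (1::real^'d) .. real n *\<^sub>R 1}) = UNIV"
  proof -
    have "\<exists>n. x \<in> {- real n *\<^sub>R (1::real^'d) .. real n *\<^sub>R 1}" for x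
    proof -
      obtain n where "norm x \<le> real n" using real_arch_simple by blast
      then have "\<bar>x $ j\<bar> \<le> real n" for j using component_le_norm_cart[of x j] by linarith
      then have "- real n \<le> x $ j \<and> x $ j \<le> real n" for j by (simp add: abs_le_iff minus_le_iff)
      then show ?thesis by (auto simp: less_eq_vec_def)
    qed
    then show ?thesis by blast
  qed
  have eq: "emeasure ?M (cbox a b) = emeasure ?N (cbox a b)" for a b
  proof -
    let ?A = "\<lambda>j. {max (a $ j) 0 .. min (b $ j) 2}"
    have c: "cell \<inter> cbox a b = cbox (\<chi> j. max (a $ j) 0) (\<chi> j. min (b $ j) (2::real))"
      by (auto simp: mem_cell mem_box_cart)
    have "emeasure ?M (cbox a b) = emeasure lborel (cell \<inter> cbox a b)"
      by (rule emeasure_restricted) (simp_all add: cell_def)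
    also have "\<dots> = (\<Prod>j\<in>UNIV. emeasure lborel (?A j))"
      unfolding c emeasure_lborel_cbox_cart by simp
    also have "\<dots> = emeasure lborel (?A i) * (\<Prod>j\<in>UNIV-{i}. emeasure lborel (?A j))"
      by (subst prod.remove[of _ i]) auto
    also have "\<dots> = emeasure I02 (?A i) * emeasure (slice_measure i) (Pi\<^sub>E (UNIV-{i}) ?A)"
      by (subst emeasure_slice) (auto simp: emeasure_restrict_space)
    also have "\<dots> = emeasure (I02 \<Otimes>\<^sub>M slice_measure i) (?A i \<times> (Pi\<^sub>E (UNIV-{i}) ?A))"
    proof (rule S.emeasure_pair_measure_Times[symmetric])
      show "?A i \<in> sets I02" by (subst sets_restrict_space_iff) auto
      show "Pi\<^sub>E (UNIV-{i}) ?A \<in> sets (slice_measure i)"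
        unfolding slice_measure_def
        by (intro sets_PiM_I_finite) (auto simp: sets_restrict_space_iff)
    qed
    \<comment> \<open>The preimage of a box under gluing is again a rectangle, because each
      coordinate condition concerns either \<open>fst z\<close> or one component of
      \<open>snd z\<close>.\<close>
    also have "?A i \<times> (Pi\<^sub>E (UNIV-{i}) ?A) =
        (\<lambda>z. glue i (fst z) (snd z)) -` cbox a b \<inter> space (I02 \<Otimes>\<^sub>M slice_measure i)"
    proof (intro set_eqI)
      fix z :: "real \<times> ('d \<Rightarrow> real)"
      obtain r y where z: "z = (r, y)" by (cases z)
      have "(\<forall>j. a $ j \<le> glue i r y $ j \<and> glue i r y $ j \<le> b $ j) \<longleftrightarrow>
          a $ i \<le> r \<and> r \<le> b $ i \<and> (\<forall>j\<in>UNIV-{i}. a $ j \<le> y j \<and> y j \<le> b $ j)"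
        by (auto simp: glue_def)
      then show "z \<in> ?A i \<times> (Pi\<^sub>E (UNIV-{i}) ?A) \<longleftrightarrow>
          z \<in> (\<lambda>z. glue i (fst z) (snd z)) -` cbox a b \<inter> space (I02 \<Otimes>\<^sub>M slice_measure i)"
        unfolding z space_pair_measure space_restrict_space space_slice
        by (simp add: mem_box_cart PiE_iff) blast
    qed
    also have "emeasure (I02 \<Otimes>\<^sub>M slice_measure i) \<dots> = emeasure ?N (cbox a b)"
      by (subst emeasure_distr[OF measurable_glue]) auto
    finally show ?thesis .
  qed
  show "emeasure ?M X = emeasure ?N X" if "X \<in> ?E" for X
    using that eq by (auto simp: interval_cbox_cart)
  show "emeasure ?M {- real n *\<^sub>R (1::real^'d) .. real n *\<^sub>R 1} \<noteq> \<infinity>" for n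
    unfolding interval_cbox_cart
    by (subst emeasure_restricted) (simp_all add: cell_def Int_interval emeasure_lborel_cbox_eq)
qed

lemma integrable_cell: "continuous_on cell f \<Longrightarrow> (f :: real^'d::finite \<Rightarrow> real) integrable_on cell"
  unfolding cell_def by (rule integrable_continuous)

text \<open>The norms are defined by Bochner integrals, while integration by parts uses the gauge
  integral \<open>integral\<close>. For continuous integrands on the compact cell the two
  agree.\<close>

lemma integral_cell_lborel:
  fixes f :: "real^'d::finite \<Rightarrow> real"
  assumes "continuous_on cell f"
  shows "integrable (restrict_space lborel cell) f"
    and "(\<integral>x. f x \<partial>restrict_space lborel cell) = integral cell f"
    and "integrable lborel (\<lambda>x. indicator cell x *\<^sub>R f x)"
    and "(\<integral>x. indicator cell x *\<^sub>R f x \<partial>lborel) = integral cell f"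
proof -
  show i: "integrable lborel (\<lambda>x. indicator cell x *\<^sub>R f x)"
    using borel_integrable_compact[OF compact_cell assms]
    by (simp add: indicator_def if_distrib[of "\<lambda>c. c *\<^sub>R _"] cong: if_cong)
  show e: "(\<integral>x. indicator cell x *\<^sub>R f x \<partial>lborel) = integral cell f"
    using set_borel_integral_eq_integral(2)[of cell f] i
    by (simp add: set_integrable_def set_lebesgue_integral_def)
  have m: "cell \<inter> space lborel \<in> sets (lborel :: (real^'d) measure)" by (simp add: cell_def)
  show "integrable (restrict_space lborel cell) f"
    using i by (subst integrable_restrict_space[OF m])
  show "(\<integral>x. f x \<partial>restrict_space lborel cell) = integral cell f"
    unfolding integral_restrict_space[OF m] e ..
qed

text \<open>Fubini with the i-th coordinate as the inner variable, in the gauge integral, so that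
  the fundamental theorem of calculus applies along each chord.\<close>

lemma integral_cell_slice:
  fixes f :: "real^'d::finite \<Rightarrow> real"
  assumes f: "continuous_on cell f"
  shows "integral cell f = (\<integral>y. integral {0..2} (\<lambda>s. f (glue i s y)) \<partial>slice_measure i)"
proof -
  interpret S: finite_measure "slice_measure i" by (rule finite_measure_slice)
  interpret J: finite_measure I02 by (rule finite_measure_interval)
  interpret P: pair_sigma_finite I02 "slice_measure i" ..
  let ?g = "\<lambda>x. indicator cell x *\<^sub>R f x"
  let ?p = "\<lambda>z. glue i (fst z) (snd z)"
  have [measurable]: "cell \<in> sets (borel :: (real^'d) measure)" by (simp add: cell_def)
  have dens: "density lborel (indicator cell) = density lborel (\<lambda>x::real^'d. ennreal (indicat_real cell x))"
    by (simp add: ennreal_indicator)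
  have gm [measurable]: "?g \<in> borel_measurable borel"
    using f by (intro borel_measurable_continuous_on_indicator) (auto simp: cell_def)
  \<comment> \<open>The indicator is inserted twice: one copy becomes the density, the other stays
    in \<open>?g\<close> and makes it Borel on the whole space, although \<open>f\<close> is
    controlled only on the cell.\<close>
  have "integral cell f = (\<integral>x. indicator cell x *\<^sub>R ?g x \<partial>lborel)"
    unfolding integral_cell_lborel(4)[OF f, symmetric] by (intro Bochner_Integration.integral_cong) (auto simp: indicator_def)
  also have "\<dots> = (\<integral>x. ?g x \<partial>density lborel (indicator cell))"
    unfolding dens by (intro integral_density[symmetric]) (use gm in auto)
  also have "\<dots> = (\<integral>z. ?g (?p z) \<partial>(I02 \<Otimes>\<^sub>M slice_measure i))"
    unfolding cell_measure_eq[of i] by (rule integral_distr[OF measurable_glue gm])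
  also have "\<dots> = (\<integral>(s, y). ?g (glue i s y) \<partial>(I02 \<Otimes>\<^sub>M slice_measure i))"
    by (simp add: case_prod_beta')
  also have "\<dots> = (\<integral>y. \<integral>s. ?g (glue i s y) \<partial>I02 \<partial>slice_measure i)"
  proof (rule P.integral_snd[symmetric])
    have "integrable (density lborel (indicator cell)) ?g"
    proof -
      have "integrable lborel (\<lambda>x. indicator cell x *\<^sub>R ?g x)"
        using integral_cell_lborel(3)[OF f]
        by (rule Bochner_Integration.integrable_cong[THEN iffD1, rotated 2]) (auto simp: indicator_def)
      then show ?thesis
        unfolding dens by (subst integrable_density) (use gm in auto)
    qed
    then have "integrable (I02 \<Otimes>\<^sub>M slice_measure i) (\<lambda>z. ?g (?p z))"
      unfolding cell_measure_eq[of i] by (rule integrable_distr[OF measurable_glue])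
    then show "integrable (I02 \<Otimes>\<^sub>M slice_measure i) (\<lambda>(s, y). ?g (glue i s y))"
      by (simp add: case_prod_beta')
  qed
  also have "\<dots> = (\<integral>y. integral {0..2} (\<lambda>s. f (glue i s y)) \<partial>slice_measure i)"
  proof (intro Bochner_Integration.integral_cong refl)
    fix y assume y: "y \<in> space (slice_measure i)"
    have c: "continuous_on {0..2} (\<lambda>s. f (glue i s y))"
    proof (rule continuous_on_compose2[OF f])
      have "continuous_on {0..2} (\<lambda>s. upd i s (glue i 0 y))" by (intro continuous_intros)
      then show "continuous_on {0..2} (\<lambda>s. glue i s y)" by simp
    qed (auto intro!: glue_in_cell y)
    have "(\<integral>s. ?g (glue i s y) \<partial>I02) = (\<integral>s. f (glue i s y) \<partial>I02)"
      using glue_in_cell[OF y] by (intro Bochner_Integration.integral_cong) (auto simp: space_restrict_space)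
    also have "\<dots> = (LINT s:{0..2}|lborel. f (glue i s y))"
      by (simp add: integral_restrict_space set_lebesgue_integral_def)
    also have "\<dots> = integral {0..2} (\<lambda>s. f (glue i s y))"
      by (intro set_borel_integral_eq_integral(2) borel_integrable_atLeastAtMost' c)
    finally show "(\<integral>s. ?g (glue i s y) \<partial>I02) = \<dots>" .
  qed
  finally show ?thesis .
qed

text \<open>The integrand is constant along chords of length 2, whence the factor 2. This trades
  face integrals for cell integrals.\<close>

lemma integral_cell_upd:
  fixes f :: "real^'d::finite \<Rightarrow> real"
  assumes f: "continuous_on (face i s) f" and s: "s \<in> {0..2}"
  shows "integral cell (\<lambda>x. f (upd i s x)) = 2 * (\<integral>y. f (glue i s y) \<partial>slice_measure i)"
proof -
  have c: "continuous_on cell (\<lambda>x. f (upd i s x))"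
    by (rule continuous_on_compose2[OF f]) (use s in \<open>auto intro!: continuous_intros upd_in_face\<close>)
  have "integral cell (\<lambda>x. f (upd i s x)) = (\<integral>y. 2 * f (glue i s y) \<partial>slice_measure i)"
    by (subst integral_cell_slice[OF c, of i]) simp
  then show ?thesis by simp
qed

text \<open>The fundamental theorem on each chord. The factor 2 turns the remaining integral over d
  - 1 coordinates into one over the cell.\<close>

lemma integral_by_parts_cell:
  fixes f :: "real^'d::finite \<Rightarrow> real"
  assumes f: "continuous_on cell f" and f': "continuous_on cell f'"
    and d: "\<And>x r. x \<in> cell \<Longrightarrow> r \<in> {0..2} \<Longrightarrow>
      ((\<lambda>r. f (upd i r x)) has_vector_derivative f' (upd i r x)) (at r within {0..2})"
  shows "2 * integral cell f' = integral cell (\<lambda>x. f (upd i 2 x) - f (upd i 0 x))"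
proof -
  have fc: "continuous_on cell (\<lambda>x. f (upd i s x))" if "s \<in> {0..2}" for s
    by (rule continuous_on_compose2[OF f]) (use that in \<open>auto intro!: continuous_intros upd_in_cell\<close>)
  have *: "integral {0..2} (\<lambda>s. f' (glue i s y)) = f (glue i 2 y) - f (glue i 0 y)"
    if y: "y \<in> space (slice_measure i)" for y
    using d[OF glue_in_cell[OF y, of 0]] by (intro integral_unique fundamental_theorem_of_calculus) auto
  have const: "integral {0..2::real} (\<lambda>s. c) = 2 * c" for c :: real by simp
  have "integral cell f' = (\<integral>y. f (glue i 2 y) - f (glue i 0 y) \<partial>slice_measure i)"
    unfolding integral_cell_slice[OF f', of i] by (intro Bochner_Integration.integral_cong) (simp_all add: *)
  also have "2 * \<dots> = (\<integral>y. integral {0..2} (\<lambda>s::real. (f (glue i 2 y) - f (glue i 0 y))) \<partial>slice_measure i)"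
    by (simp only: const integral_mult_right_zero)
  also have "\<dots> = integral cell (\<lambda>x. f (upd i 2 x) - f (upd i 0 x))"
    by (subst integral_cell_slice[of _ i]) (auto intro!: continuous_on_diff fc)
  finally show ?thesis .
qed

section \<open>Surface measure of the faces\<close>

lemma measurable_glue_face:
  assumes s: "s \<in> {0..2}"
  shows "glue i s \<in> slice_measure i \<rightarrow>\<^sub>M restrict_space borel (face i s)"
proof (rule measurable_restrict_space2)
  show "glue i s \<in> space (slice_measure i) \<rightarrow> face i s"
    using s by (auto simp: face_def glue_in_cell) (simp add: glue_def)
  have "(\<lambda>z. glue i (fst z) (snd z)) \<circ> (\<lambda>y. (s, y)) \<in> borel_measurable (slice_measure i)"
    by (rule measurable_comp[OF _ measurable_glue]) (use s in \<open>auto intro!: measurable_Pair1' simp: space_restrict_space\<close>)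
  then show "glue i s \<in> borel_measurable (slice_measure i)" by (simp add: comp_def)
qed

lemma face_measure_alt: "face_measure i s = distr (slice_measure i) (restrict_space borel (face i s)) (glue i s)"
  by (simp add: face_measure_def slice_measure_def glue_def[abs_def])

lemma finite_face_measure:
  assumes "s \<in> {0..2}" shows "finite_measure (face_measure i s)"
  unfolding face_measure_alt
  by (intro finite_measure.finite_measure_distr finite_measure_slice measurable_glue_face assms)

lemma measure_face:
  assumes "s \<in> {0..2}"
  shows "measure (face_measure (i::'d::finite) s) (face i s) = 2 ^ (CARD('d) - 1)"
proof -
  have "measure (face_measure i s) (face i s) = measure (slice_measure i) (glue i s -` face i s \<inter> space (slice_measure i))"
    unfolding face_measure_alt by (rule measure_distr[OF measurable_glue_face[OF assms]]) (metis sets.top space_borel space_restrict_space Int_UNIV_right)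
  also have "glue i s -` face i s \<inter> space (slice_measure i) = space (slice_measure i)"
    using measurable_space[OF measurable_glue_face[OF assms]] by (auto simp: space_restrict_space)
  finally show ?thesis by (simp add: measure_slice)
qed

text \<open>There are 2d faces, each of area 2^(d-1).\<close>

lemma boundary_area_eq: "boundary_area TYPE('d::finite) = real CARD('d) * 2 ^ CARD('d)"
proof -
  have "CARD('d) = Suc (CARD('d) - 1)" by simp
  then have "(2::real) ^ CARD('d) = 2 * 2 ^ (CARD('d) - 1)" by (metis power_Suc)
  then show ?thesis
    by (simp add: boundary_area_def measure_face)
qed

text \<open>Rewrites the integrals inside \<open>L2_norm_boundary\<close> as iterated integrals over
  cell and time; the factor 2 is that of \<open>integral_cell_upd\<close>. Continuity on a compact
  set gives boundedness, hence the integrability required by Fubini.\<close>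

lemma integral_face_time:
  fixes g :: "(real^'d::finite) \<times> real \<Rightarrow> real"
  assumes g: "continuous_on (face i s \<times> {0..T}) g" and s: "s \<in> {0..2}"
  shows "integral {0..T} (\<lambda>t. integral cell (\<lambda>x. g (upd i s x, t)))
    = 2 * (\<integral>z. g z \<partial>(face_measure i s \<Otimes>\<^sub>M restrict_space lborel {0..T}))"
proof -
  let ?T = "restrict_space lborel {0..T}" and ?F = "face_measure i s"
  interpret F: finite_measure ?F by (rule finite_face_measure[OF s])
  interpret J: finite_measure ?T by (rule finite_measure_interval)
  interpret P: pair_sigma_finite ?F ?T ..
  interpret PF: finite_measure "?F \<Otimes>\<^sub>M ?T" by (rule finite_measure_pair_measure) unfold_locales
  have spF: "space ?F = face i s" by (simp add: face_measure_alt space_restrict_space)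
  have spP: "space (?F \<Otimes>\<^sub>M ?T) = face i s \<times> {0..T}"
    by (simp add: space_pair_measure spF space_restrict_space)
  have setF: "sets ?F = sets (restrict_space borel (face i s))" by (simp add: face_measure_alt)
  have "face i s = cell \<inter> {x. x $ i = s}" by (auto simp: face_def)
  moreover have "closed {x :: real^'d. x $ i = s}"
    by (intro closed_Collect_eq continuous_intros)
  ultimately have "compact (face i s)" using compact_Int_closed[OF compact_cell] by simp
  then have comp: "compact (face i s \<times> {0..T})" by (intro compact_Times) auto
  \<comment> \<open>Measurability of \<open>id\<close> says that the product sigma-algebra contains
    the Borel sets of the product of face and time interval; hence the continuous \<open>g\<close>
    is measurable.\<close>
  have "id \<in> ?F \<Otimes>\<^sub>M ?T \<rightarrow>\<^sub>M restrict_space borel (face i s \<times> {0..T})"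
  proof (rule measurable_restrict_space2)
    have "fst \<in> borel_measurable (?F \<Otimes>\<^sub>M ?T)"
      using measurable_fst[of ?F ?T] unfolding measurable_cong_sets[OF refl setF]
      by (simp add: measurable_restrict_space2_iff)
    moreover have "snd \<in> borel_measurable (?F \<Otimes>\<^sub>M ?T)"
      using measurable_snd[of ?F ?T] by (simp add: measurable_restrict_space2_iff)
    ultimately have "(\<lambda>z. (fst z, snd z)) \<in> borel_measurable (?F \<Otimes>\<^sub>M ?T)"
      by (rule borel_measurable_Pair)
    then show "id \<in> borel_measurable (?F \<Otimes>\<^sub>M ?T)" by (simp add: id_def)
  qed (auto simp: spP)
  from measurable_comp[OF this borel_measurable_continuous_on_restrict[OF g]]
  have gm: "g \<in> borel_measurable (?F \<Otimes>\<^sub>M ?T)" by simp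
  obtain B where B: "\<And>z. z \<in> face i s \<times> {0..T} \<Longrightarrow> norm (g z) \<le> B"
    using compact_imp_bounded[OF compact_continuous_image[OF g comp]] by (auto simp: bounded_iff)
  have int: "integrable (?F \<Otimes>\<^sub>M ?T) g"
    by (rule PF.integrable_const_bound[of _ B]) (use B gm in \<open>auto simp: spP intro!: AE_I2\<close>)
  have gc: "continuous_on (face i s) (\<lambda>x. g (x, t))" if "t \<in> {0..T}" for t
    by (rule continuous_on_compose2[OF g]) (use that in \<open>auto intro!: continuous_intros\<close>)
  have inner: "2 * (\<integral>x. g (x, t) \<partial>?F) = integral cell (\<lambda>x. g (upd i s x, t))" if "t \<in> {0..T}" for t
  proof -
    have "(\<integral>x. g (x, t) \<partial>?F) = (\<integral>y. g (glue i s y, t) \<partial>slice_measure i)"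
      unfolding face_measure_alt
      by (rule integral_distr[OF measurable_glue_face[OF s]])
        (rule borel_measurable_continuous_on_restrict[OF gc[OF that]])
    then show ?thesis using integral_cell_upd[OF gc[OF that] s] by simp
  qed
  have "continuous_on {0..T} (\<lambda>t. integral cell (\<lambda>x. g (upd i s x, t)))"
    unfolding cell_def
    by (rule integral_continuous_on_param, unfold case_prod_beta, rule continuous_on_compose2[OF g])
      (use s in \<open>auto intro!: continuous_intros upd_in_face simp: cell_def[symmetric]\<close>)
  then have ct: "set_integrable lborel {0..T} (\<lambda>t. integral cell (\<lambda>x. g (upd i s x, t)))"
    by (rule borel_integrable_atLeastAtMost')
  have "(\<integral>z. g z \<partial>(?F \<Otimes>\<^sub>M ?T)) = (\<integral>t. \<integral>x. g (x, t) \<partial>?F \<partial>?T)"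
    using P.integral_snd[of "\<lambda>x t. g (x, t)"] int by simp
  then have "2 * (\<integral>z. g z \<partial>(?F \<Otimes>\<^sub>M ?T)) = (\<integral>t. 2 * (\<integral>x. g (x, t) \<partial>?F) \<partial>?T)" by simp
  also have "\<dots> = (\<integral>t. integral cell (\<lambda>x. g (upd i s x, t)) \<partial>?T)"
    by (intro Bochner_Integration.integral_cong) (auto simp: space_restrict_space inner)
  also have "\<dots> = (LINT t:{0..T}|lborel. integral cell (\<lambda>x. g (upd i s x, t)))"
    by (simp add: integral_restrict_space set_lebesgue_integral_def)
  also have "\<dots> = integral {0..T} (\<lambda>t. integral cell (\<lambda>x. g (upd i s x, t)))"
    by (rule set_borel_integral_eq_integral(2)[OF ct])
  finally show ?thesis by simp
qed

section \<open>The energy inequality at a fixed time\<close>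

text \<open>Differentiability along whole chords, one-sided at their ends, is what
  \<open>integral_by_parts_cell\<close> consumes. Passing \<open>f'\<close> as an argument keeps the
  energy inequality purely spatial, independent of \<open>partial\<close> and of time.\<close>

definition has_dx :: "'d::finite \<Rightarrow> (real^'d \<Rightarrow> 'b::real_normed_vector) \<Rightarrow> (real^'d \<Rightarrow> 'b) \<Rightarrow> bool" where
  "has_dx i f f' \<longleftrightarrow> continuous_on cell f \<and> continuous_on cell f' \<and>
     (\<forall>x\<in>cell. \<forall>r\<in>{0..2}.
        ((\<lambda>r. f (upd i r x)) has_vector_derivative f' (upd i r x)) (at r within {0..2}))"

lemma has_dx_inner:
  assumes "has_dx i f f'" "has_dx i g g'"
  shows "has_dx i (\<lambda>x. f x \<bullet> g x) (\<lambda>x. f x \<bullet> g' x + f' x \<bullet> g x)"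
  using assms unfolding has_dx_def
  by (auto intro!: continuous_intros bounded_bilinear.has_vector_derivative[OF bounded_bilinear_inner])

lemma has_dx_scaleR:
  assumes "has_dx i f f'" "has_dx i g g'"
  shows "has_dx i (\<lambda>x. f x *\<^sub>R g x) (\<lambda>x. f x *\<^sub>R g' x + f' x *\<^sub>R g x)"
  using assms unfolding has_dx_def
  by (auto intro!: continuous_intros bounded_bilinear.has_vector_derivative[OF bounded_bilinear_scaleR])

lemma has_dx_nth:
  assumes "has_dx i f f'"
  shows "has_dx i (\<lambda>x. f x $ j) (\<lambda>x. f' x $ j)"
  using assms unfolding has_dx_def
  by (auto intro!: continuous_intros bounded_linear.has_vector_derivative[OF bounded_linear_vec_nth])

text \<open>
  Integrating the jump, which does not depend on \<open>x\<^sub>i\<close>, over the whole cell instead of the face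
  gains a factor \<open>2\<close>, the width of the cell.
\<close>

definition jump_integral :: "'d::finite \<Rightarrow> (real^'d \<Rightarrow> 'b::real_normed_vector) \<Rightarrow> real" where
  "jump_integral i f = integral cell (\<lambda>x. norm (f (upd i 2 x) - f (upd i 0 x))) / 2"

lemma continuous_on_cell_upd:
  "continuous_on cell f \<Longrightarrow> s \<in> {0..2} \<Longrightarrow> continuous_on cell (\<lambda>x. f (upd i s x))"
  by (rule continuous_on_compose2) (auto intro!: continuous_intros upd_in_cell)

text \<open>For a non-integrable integrand the integral takes its default value 0, so the sign holds
  for every \<open>f\<close>.\<close>

lemma jump_integral_nonneg: "jump_integral i f \<ge> 0"
proof (cases "(\<lambda>x. norm (f (upd i 2 x) - f (upd i 0 x))) integrable_on cell")
  case True
  then show ?thesis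
    by (simp add: jump_integral_def Henstock_Kurzweil_Integration.integral_nonneg)
qed (simp add: jump_integral_def not_integrable_integral)

lemma integral_cell_mono:
  fixes f g :: "real^'d::finite \<Rightarrow> real"
  assumes "continuous_on cell f" "continuous_on cell g" "\<And>x. x \<in> cell \<Longrightarrow> f x \<le> g x"
  shows "integral cell f \<le> integral cell g"
  using assms by (intro integral_le integrable_cell)

text \<open>The integrand is the derivative of \<open>f \<bullet> g\<close>, so only values at chord
  ends remain. Splitting their difference by a discrete product rule leaves one jump per term, times
  a supremum. Periodic boundary values would give zero; here the jumps measure the defect.\<close>

lemma green_bound:
  fixes f g :: "real^'d::finite \<Rightarrow> 'b::euclidean_space"
  assumes f: "has_dx i f f'" and g: "has_dx i g g'"
    and F: "\<And>x. x \<in> cell \<Longrightarrow> norm (f x) \<le> F" and G: "\<And>x. x \<in> cell \<Longrightarrow> norm (g x) \<le> G"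
  shows "\<bar>integral cell (\<lambda>x. f x \<bullet> g' x + f' x \<bullet> g x)\<bar> \<le> G * jump_integral i f + F * jump_integral i g"
proof -
  have fc: "continuous_on cell f" and gc: "continuous_on cell g" using f g by (auto simp: has_dx_def)
  note [continuous_intros] = continuous_on_cell_upd[OF fc] continuous_on_cell_upd[OF gc]
  let ?h = "\<lambda>x. f (upd i 2 x) \<bullet> g (upd i 2 x) - f (upd i 0 x) \<bullet> g (upd i 0 x)"
  let ?k = "\<lambda>x. G * norm (f (upd i 2 x) - f (upd i 0 x)) + F * norm (g (upd i 2 x) - g (upd i 0 x))"
  have "2 * integral cell (\<lambda>x. f x \<bullet> g' x + f' x \<bullet> g x) = integral cell ?h"
    using has_dx_inner[OF f g] unfolding has_dx_def by (intro integral_by_parts_cell) auto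
  moreover have "norm (integral cell ?h) \<le> integral cell ?k"
  proof (rule integral_norm_bound_integral)
    show "?h integrable_on cell" "?k integrable_on cell"
      by (intro integrable_cell continuous_intros; simp)+
    fix x :: "real^'d" assume x: "x \<in> cell"
    let ?f2 = "f (upd i 2 x)" and ?f0 = "f (upd i 0 x)" and ?g2 = "g (upd i 2 x)" and ?g0 = "g (upd i 0 x)"
    have "?h x = (?f2 - ?f0) \<bullet> ?g2 + ?f0 \<bullet> (?g2 - ?g0)" by (simp add: inner_simps)
    also have "norm \<dots> \<le> norm (?f2 - ?f0) * norm ?g2 + norm ?f0 * norm (?g2 - ?g0)"
      by (intro norm_triangle_le add_mono) (simp_all add: Cauchy_Schwarz_ineq2)
    also have "\<dots> \<le> norm (?f2 - ?f0) * G + F * norm (?g2 - ?g0)"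
      using x by (intro add_mono mult_left_mono mult_right_mono F G upd_in_cell) auto
    finally show "norm (?h x) \<le> ?k x" by (simp add: mult.commute)
  qed
  moreover have "integral cell ?k = 2 * (G * jump_integral i f + F * jump_integral i g)"
    unfolding jump_integral_def
    by (subst Henstock_Kurzweil_Integration.integral_add) (auto intro!: integrable_cell continuous_intros)
  ultimately show ?thesis by (simp add: abs_le_iff)
qed

text \<open>The map from v to \<open>v $ j *\<^sub>R v\<close> is quadratic, hence Lipschitz with
  constant 2b on the ball of radius b.\<close>

lemma jump_integral_scaleR_nth:
  fixes v :: "real^'d::finite \<Rightarrow> real^'d"
  assumes v: "continuous_on cell v" and b: "\<And>x. x \<in> cell \<Longrightarrow> norm (v x) \<le> b"
  shows "jump_integral i (\<lambda>x. v x $ j *\<^sub>R v x) \<le> 2 * b * jump_integral i v"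
proof -
  note [continuous_intros] = continuous_on_cell_upd[OF v]
  let ?v2 = "\<lambda>x. v (upd i 2 x)" and ?v0 = "\<lambda>x. v (upd i 0 x)"
  have "integral cell (\<lambda>x. norm (?v2 x $ j *\<^sub>R ?v2 x - ?v0 x $ j *\<^sub>R ?v0 x))
      \<le> integral cell (\<lambda>x. 2 * b * norm (?v2 x - ?v0 x))"
  proof (rule integral_cell_mono)
    fix x :: "real^'d" assume x: "x \<in> cell"
    have "0 \<le> b" using b[OF x] norm_ge_zero order_trans by blast
    have "?v2 x $ j *\<^sub>R ?v2 x - ?v0 x $ j *\<^sub>R ?v0 x
        = (?v2 x - ?v0 x) $ j *\<^sub>R ?v2 x + ?v0 x $ j *\<^sub>R (?v2 x - ?v0 x)"
      by (simp add: algebra_simps)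
    also have "norm \<dots> \<le> \<bar>(?v2 x - ?v0 x) $ j\<bar> * norm (?v2 x) + \<bar>?v0 x $ j\<bar> * norm (?v2 x - ?v0 x)"
      by (intro norm_triangle_le) simp
    also have "\<dots> \<le> norm (?v2 x - ?v0 x) * b + b * norm (?v2 x - ?v0 x)"
      using x by (intro add_mono mult_mono component_le_norm_cart b upd_in_cell order_trans[OF component_le_norm_cart])
        (use \<open>0 \<le> b\<close> in auto)
    finally show "norm (?v2 x $ j *\<^sub>R ?v2 x - ?v0 x $ j *\<^sub>R ?v0 x) \<le> 2 * b * norm (?v2 x - ?v0 x)"
      by simp
  qed (intro continuous_intros; simp)+
  then show ?thesis by (simp add: jump_integral_def)
qed

text \<open>Here \<open>dv i\<close>, \<open>ddv i\<close> are first and pure second derivatives of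
  \<open>v\<close>, and \<open>w\<close> is its Laplacian. \<open>P\<close> and \<open>Q\<close>
  duplicate the bounds \<open>b\<close> and \<open>a\<close> on \<open>v\<close> and
  \<open>u\<close> on purpose: \<open>P\<close>, \<open>Q\<close> enter the growth rate, while
  \<open>a\<close>, \<open>b\<close>, \<open>m\<close> only multiply residuals.\<close>

lemma energy_inequality:
  fixes v u w R vt :: "real^'d::finite \<Rightarrow> real^'d" and lam a b m P Q :: real
  assumes v: "\<And>i. has_dx i v (dv i)" and dv: "\<And>i. has_dx i (dv i) (ddv i)"
    and w: "\<And>i. has_dx i w (dw i)" and dw: "\<And>i. has_dx i (dw i) (ddw i)"
    and u: "\<And>i. has_dx i u (du i)"
    and w_def: "\<And>x. x \<in> cell \<Longrightarrow> w x = (\<Sum>i\<in>UNIV. ddv i x)"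
    and R: "continuous_on cell R"
    and b: "\<And>x. x \<in> cell \<Longrightarrow> norm (v x) \<le> b" "\<And>x i. x \<in> cell \<Longrightarrow> norm (dv i x) \<le> b"
    and m: "\<And>x. x \<in> cell \<Longrightarrow> norm (w x) \<le> m" "\<And>x i. x \<in> cell \<Longrightarrow> norm (dw i x) \<le> m" "b \<le> m"
    and a: "\<And>x. x \<in> cell \<Longrightarrow> norm (u x) \<le> a"
    and P: "\<And>x. x \<in> cell \<Longrightarrow> norm (v x) \<le> P" and Q: "\<And>x. x \<in> cell \<Longrightarrow> norm (u x) \<le> Q"
    and per: "\<And>x i. x \<in> cell \<Longrightarrow> u (upd i 2 x) = u (upd i 0 x)"
    and eq: "\<And>x. x \<in> cell \<Longrightarrow> vt x = R x - (\<Sum>j\<in>UNIV. v x $ j *\<^sub>R dv j x) - (\<Sum>j\<in>UNIV. u x $ j *\<^sub>R dv j x)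
        - (\<Sum>j\<in>UNIV. v x $ j *\<^sub>R du j x) - lam *\<^sub>R w x - (\<Sum>i\<in>UNIV. ddw i x)"
  shows "2 * integral cell (\<lambda>x. v x \<bullet> vt x) \<le>
     (18 * real CARD('d) * (P\<^sup>2 + Q\<^sup>2) + 1/2 + 2 * lam\<^sup>2) * integral cell (\<lambda>x. (norm (v x))\<^sup>2)
     + 2 * b * integral cell (\<lambda>x. norm (R x))
     + (b + 4 * a * b + 2 * m) * (\<Sum>i\<in>UNIV. jump_integral i v + jump_integral i (dv i)
          + jump_integral i w + jump_integral i (dw i))"
proof -
  have cont: "continuous_on cell v" "continuous_on cell w" "continuous_on cell u"
     "continuous_on cell (dv i)" "continuous_on cell (ddv i)" "continuous_on cell (du i)"
     "continuous_on cell (dw i)" "continuous_on cell (ddw i)" for i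
    using v dv w dw u by (auto simp: has_dx_def)
  note ci [continuous_intros] = cont R
  have cell0: "0 \<in> (cell :: (real^'d) set)" by (simp add: mem_cell)
  have pos: "0 \<le> b" "0 \<le> m" "0 \<le> a"
    using b(1)[OF cell0] m(1)[OF cell0] a[OF cell0] norm_ge_zero order_trans by blast+
  let ?I = "integral (cell :: (real^'d) set)"
  define E where "E = ?I (\<lambda>x. (norm (v x))\<^sup>2)"
  define L where "L = ?I (\<lambda>x. (norm (w x))\<^sup>2)"
  define N where "N j = ?I (\<lambda>x. (norm (dv j x))\<^sup>2)" for j
  define V where "V = ?I (\<lambda>x. v x \<bullet> w x)"
  define j where "j i = jump_integral i v + jump_integral i (dv i) + jump_integral i w + jump_integral i (dw i)" for i
  define J where "J = (\<Sum>i\<in>UNIV. j i)"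
  define f where "f i x = v x $ i *\<^sub>R v x" for i x
  define f' where "f' i x = v x $ i *\<^sub>R dv i x + dv i x $ i *\<^sub>R v x" for i x
  have f: "has_dx i (f i) (f' i)" for i
    unfolding f_def[abs_def] f'_def[abs_def] by (intro has_dx_scaleR has_dx_nth v)
  have fc [continuous_intros]: "continuous_on cell (f i)" "continuous_on cell (f' i)" for i
    using f by (auto simp: has_dx_def)
  \<comment> \<open>What is left of the advection after the exact derivative of
    \<open>f i \<bullet> u\<close> has been split off; hence the subtracted
    \<open>f' i x \<bullet> u x\<close>.\<close>
  define T where "T i x = v x \<bullet> (v x $ i *\<^sub>R dv i x) + v x \<bullet> (u x $ i *\<^sub>R dv i x) - f' i x \<bullet> u x" for i x
  have Tc [continuous_intros]: "continuous_on cell (T i)" for i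
    unfolding T_def[abs_def] by (intro continuous_intros)
  note ic = integrable_cell
  have jn: "0 \<le> jump_integral i v" "0 \<le> jump_integral i (dv i)" "0 \<le> jump_integral i w" "0 \<le> jump_integral i (dw i)" for i
    by (rule jump_integral_nonneg)+

  text \<open>Green's formula twice in each direction, so that no mixed derivatives have to be commuted.\<close>
  have bilap: "- ?I (\<lambda>x. \<Sum>i\<in>UNIV. v x \<bullet> ddw i x) \<le> - L + m * J"
  proof -
    have one: "- ?I (\<lambda>x. v x \<bullet> ddw i x) \<le> - ?I (\<lambda>x. ddv i x \<bullet> w x) + m * j i" for i
    proof -
      have "\<bar>?I (\<lambda>x. v x \<bullet> ddw i x + dv i x \<bullet> dw i x)\<bar> \<le> m * jump_integral i v + b * jump_integral i (dw i)"
        by (rule green_bound[OF v dw b(1) m(2)])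
      moreover have "\<bar>?I (\<lambda>x. dv i x \<bullet> dw i x + ddv i x \<bullet> w x)\<bar> \<le> m * jump_integral i (dv i) + b * jump_integral i w"
        by (rule green_bound[OF dv w b(2) m(1)])
      moreover have "b * jump_integral i (dw i) \<le> m * jump_integral i (dw i)"
          "b * jump_integral i w \<le> m * jump_integral i w"
        using m(3) jn by (auto intro!: mult_right_mono)
      moreover have "?I (\<lambda>x. v x \<bullet> ddw i x + dv i x \<bullet> dw i x) = ?I (\<lambda>x. v x \<bullet> ddw i x) + ?I (\<lambda>x. dv i x \<bullet> dw i x)"
        "?I (\<lambda>x. dv i x \<bullet> dw i x + ddv i x \<bullet> w x) = ?I (\<lambda>x. dv i x \<bullet> dw i x) + ?I (\<lambda>x. ddv i x \<bullet> w x)"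
        by (rule Henstock_Kurzweil_Integration.integral_add; intro ic continuous_intros)+
      ultimately show ?thesis unfolding j_def by (simp add: algebra_simps abs_le_iff)
    qed
    have "L = ?I (\<lambda>x. \<Sum>i\<in>UNIV. ddv i x \<bullet> w x)"
      unfolding L_def by (intro Henstock_Kurzweil_Integration.integral_cong) (simp add: w_def power2_norm_eq_inner inner_sum_left)
    also have "\<dots> = (\<Sum>i\<in>UNIV. ?I (\<lambda>x. ddv i x \<bullet> w x))"
      by (rule Henstock_Kurzweil_Integration.integral_sum) (auto intro!: ic continuous_intros)
    finally have L: "L = \<dots>" .
    have "- ?I (\<lambda>x. \<Sum>i\<in>UNIV. v x \<bullet> ddw i x) = (\<Sum>i\<in>UNIV. - ?I (\<lambda>x. v x \<bullet> ddw i x))"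
      by (subst Henstock_Kurzweil_Integration.integral_sum) (auto intro!: ic continuous_intros simp: sum_negf)
    also have "\<dots> \<le> (\<Sum>i\<in>UNIV. - ?I (\<lambda>x. ddv i x \<bullet> w x) + m * j i)"
      by (rule sum_mono) (rule one)
    also have "\<dots> = - L + m * J"
      unfolding L J_def by (simp add: sum.distrib sum_negf sum_subtractf sum_distrib_left)
    finally show ?thesis .
  qed

  have grad: "(\<Sum>i\<in>UNIV. N i) \<le> - V + b * J"
  proof -
    have one: "N i \<le> - ?I (\<lambda>x. v x \<bullet> ddv i x) + b * j i" for i
    proof -
      have "\<bar>?I (\<lambda>x. v x \<bullet> ddv i x + dv i x \<bullet> dv i x)\<bar> \<le> b * jump_integral i v + b * jump_integral i (dv i)"
        by (rule green_bound[OF v dv b(1) b(2)])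
      moreover have "?I (\<lambda>x. v x \<bullet> ddv i x + dv i x \<bullet> dv i x) = ?I (\<lambda>x. v x \<bullet> ddv i x) + N i"
        unfolding N_def power2_norm_eq_inner
        by (rule Henstock_Kurzweil_Integration.integral_add; intro ic continuous_intros)
      moreover have "0 \<le> b * jump_integral i w" "0 \<le> b * jump_integral i (dw i)" using pos jn by auto
      ultimately show ?thesis unfolding j_def by (simp add: algebra_simps abs_le_iff)
    qed
    have "V = ?I (\<lambda>x. \<Sum>i\<in>UNIV. v x \<bullet> ddv i x)"
      unfolding V_def by (intro Henstock_Kurzweil_Integration.integral_cong) (simp add: w_def inner_sum_right)
    also have "\<dots> = (\<Sum>i\<in>UNIV. ?I (\<lambda>x. v x \<bullet> ddv i x))"
      by (rule Henstock_Kurzweil_Integration.integral_sum) (auto intro!: ic continuous_intros)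
    finally have V: "V = \<dots>" .
    have "(\<Sum>i\<in>UNIV. N i) \<le> (\<Sum>i\<in>UNIV. - ?I (\<lambda>x. v x \<bullet> ddv i x) + b * j i)"
      by (rule sum_mono) (rule one)
    also have "\<dots> = - V + b * J"
      unfolding V J_def by (simp add: sum.distrib sum_negf sum_subtractf sum_distrib_left)
    finally show ?thesis .
  qed

  text \<open>
    \<open>f i \<bullet> du i = v\<^sub>i (v \<bullet> \<partial>\<^sub>i u)\<close>: moving the derivative off \<open>u\<close> avoids any norm of \<open>\<nabla>u\<close>, and
    since \<open>u\<close> is periodic only the jump of \<open>v\<close> appears on the boundary.
  \<close>
  have trilin: "- ?I (\<lambda>x. \<Sum>i\<in>UNIV. f i x \<bullet> du i x + f' i x \<bullet> u x) \<le> 2 * a * b * J"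
  proof -
    have one: "- ?I (\<lambda>x. f i x \<bullet> du i x + f' i x \<bullet> u x) \<le> 2 * a * b * j i" for i
    proof -
      have nf: "norm (f i x) \<le> b * b" if "x \<in> cell" for x
        unfolding f_def norm_scaleR using that pos
        by (intro mult_mono b order_trans[OF component_le_norm_cart]) (auto intro: b)
      have "\<bar>?I (\<lambda>x. f i x \<bullet> du i x + f' i x \<bullet> u x)\<bar> \<le> a * jump_integral i (f i) + b * b * jump_integral i u"
        by (rule green_bound[OF f u nf a])
      moreover have "jump_integral i u = 0"
      proof -
        have "?I (\<lambda>x. norm (u (upd i 2 x) - u (upd i 0 x))) = ?I (\<lambda>x. 0)"
          by (intro Henstock_Kurzweil_Integration.integral_cong) (simp add: per)
        then show ?thesis by (simp add: jump_integral_def)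
      qed
      moreover have "jump_integral i (f i) \<le> 2 * b * jump_integral i v"
        unfolding f_def[abs_def] by (rule jump_integral_scaleR_nth) (auto intro: cont b)
      then have "a * jump_integral i (f i) \<le> a * (2 * b * jump_integral i v)"
        using pos(3) by (rule mult_left_mono)
      moreover have "a * (2 * b * jump_integral i v) \<le> a * (2 * b * j i)"
        using pos jn by (intro mult_left_mono) (auto simp: j_def)
      ultimately show ?thesis by (simp add: abs_le_iff mult_ac)
    qed
    have "- ?I (\<lambda>x. \<Sum>i\<in>UNIV. f i x \<bullet> du i x + f' i x \<bullet> u x)
        = (\<Sum>i\<in>UNIV. - ?I (\<lambda>x. f i x \<bullet> du i x + f' i x \<bullet> u x))"
      by (subst Henstock_Kurzweil_Integration.integral_sum) (auto intro!: ic continuous_intros simp: sum_negf)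
    also have "\<dots> \<le> (\<Sum>i\<in>UNIV. 2 * a * b * j i)" by (rule sum_mono) (rule one)
    finally show ?thesis by (simp add: J_def sum_distrib_left)
  qed

  have advection: "- 2 * ?I (\<lambda>x. \<Sum>i\<in>UNIV. T i x)
      \<le> 18 * real CARD('d) * (P\<^sup>2 + Q\<^sup>2) * E + (\<Sum>i\<in>UNIV. N i)"
  proof -
    have one: "- 2 * T i x \<le> 18 * (P\<^sup>2 + Q\<^sup>2) * (norm (v x))\<^sup>2 + (norm (dv i x))\<^sup>2" if x: "x \<in> cell" for i x
    proof -
      let ?n = "norm (v x)" and ?d = "norm (dv i x)"
      have c: "\<bar>v x $ i\<bar> \<le> ?n" "\<bar>v x $ i\<bar> \<le> P" "\<bar>u x $ i\<bar> \<le> Q" "norm (u x) \<le> Q" "\<bar>dv i x $ i\<bar> \<le> ?d"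
        using component_le_norm_cart[of "v x" i] component_le_norm_cart[of "u x" i]
          component_le_norm_cart[of "dv i x" i] P[OF x] Q[OF x] by linarith+
      have "\<bar>v x \<bullet> (v x $ i *\<^sub>R dv i x)\<bar> \<le> ?n * (P * ?d)"
        using c by (intro order_trans[OF Cauchy_Schwarz_ineq2] mult_left_mono)
          (auto intro!: mult_right_mono)
      moreover have "\<bar>v x \<bullet> (u x $ i *\<^sub>R dv i x)\<bar> \<le> ?n * (Q * ?d)"
        using c by (intro order_trans[OF Cauchy_Schwarz_ineq2] mult_left_mono)
          (auto intro!: mult_right_mono)
      moreover have "\<bar>f' i x \<bullet> u x\<bar> \<le> (?n * ?d + ?d * ?n) * Q"
        unfolding f'_def using c
        by (intro order_trans[OF Cauchy_Schwarz_ineq2] mult_mono norm_triangle_le add_mono)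
          (auto intro!: mult_right_mono)
      \<comment> \<open>In \<open>P + 3 * Q\<close> one Q comes from the factor
        \<open>u x $ i\<close> and two from the product rule in \<open>f'\<close>. The Young
        inequality that follows gives the gradient weight exactly 1, so that the \<open>N i\<close>
        can be summed and replaced through \<open>grad\<close>.\<close>
      ultimately have "- 2 * T i x \<le> 2 * ((P + 3 * Q) * ?n) * ?d"
        unfolding T_def by (simp add: algebra_simps abs_le_iff)
      also have "\<dots> \<le> ((P + 3 * Q) * ?n)\<^sup>2 + ?d\<^sup>2" by (rule sum_squares_bound)
      also have "((P + 3 * Q) * ?n)\<^sup>2 \<le> 18 * (P\<^sup>2 + Q\<^sup>2) * ?n\<^sup>2"
      proof -
        \<comment> \<open>From 2PQ <= P^2 + Q^2 the left side is at most 4P^2 + 12Q^2; 18 leaves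
          room.\<close>
        have "(P + 3 * Q)\<^sup>2 \<le> 18 * (P\<^sup>2 + Q\<^sup>2)"
          using sum_squares_bound[of P Q] zero_le_power2[of P] zero_le_power2[of Q]
          by (simp add: power2_sum power_mult_distrib; linarith)
        then show ?thesis by (simp add: power_mult_distrib mult_right_mono)
      qed
      finally show ?thesis by simp
    qed
    have "- 2 * ?I (\<lambda>x. \<Sum>i\<in>UNIV. T i x) = ?I (\<lambda>x. \<Sum>i\<in>UNIV. - 2 * T i x)"
      by (simp only: sum_distrib_left[symmetric] Henstock_Kurzweil_Integration.integral_mult_right)
    also have "\<dots> \<le> ?I (\<lambda>x. \<Sum>i\<in>UNIV. 18 * (P\<^sup>2 + Q\<^sup>2) * (norm (v x))\<^sup>2 + (norm (dv i x))\<^sup>2)"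
      by (intro integral_cell_mono sum_mono one continuous_intros)
    also have "\<dots> = (\<Sum>i\<in>UNIV. ?I (\<lambda>x. 18 * (P\<^sup>2 + Q\<^sup>2) * (norm (v x))\<^sup>2 + (norm (dv i x))\<^sup>2))"
      by (rule Henstock_Kurzweil_Integration.integral_sum) (auto intro!: ic continuous_intros)
    also have "\<dots> = (\<Sum>i\<in>UNIV. 18 * (P\<^sup>2 + Q\<^sup>2) * E + N i)"
      unfolding E_def N_def
      by (intro sum.cong refl, subst Henstock_Kurzweil_Integration.integral_add)
        (auto intro!: ic continuous_intros)
    also have "\<dots> = 18 * real CARD('d) * (P\<^sup>2 + Q\<^sup>2) * E + (\<Sum>i\<in>UNIV. N i)"
      by (simp add: sum.distrib algebra_simps)
    finally show ?thesis .
  qed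

  \<comment> \<open>The weights are chosen so that each use costs \<open>L / 2\<close>: the first
    after halving, inside the gradient bound, the second directly.\<close>
  have VE: "- 2 * V \<le> E + L" "- 2 * lam * V \<le> 2 * lam\<^sup>2 * E + L / 2"
  proof -
    have "?I (\<lambda>x. - 2 * (v x \<bullet> w x)) \<le> ?I (\<lambda>x. (norm (v x))\<^sup>2 + (norm (w x))\<^sup>2)"
    proof (intro integral_cell_mono continuous_intros)
      fix x
      have "0 \<le> (norm (v x + w x))\<^sup>2" by simp
      then show "- 2 * (v x \<bullet> w x) \<le> (norm (v x))\<^sup>2 + (norm (w x))\<^sup>2"
        by (simp add: power2_norm_eq_inner inner_simps inner_commute)
    qed
    also have "\<dots> = E + L" unfolding E_def L_def
      by (rule Henstock_Kurzweil_Integration.integral_add; intro ic continuous_intros)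
    finally show "- 2 * V \<le> E + L" by (simp add: V_def)
    have "?I (\<lambda>x. - 2 * lam * (v x \<bullet> w x)) \<le> ?I (\<lambda>x. 2 * lam\<^sup>2 * (norm (v x))\<^sup>2 + 1/2 * (norm (w x))\<^sup>2)"
    proof (intro integral_cell_mono continuous_intros)
      fix x
      \<comment> \<open>Half of this expanded square is the weighted Young inequality, whatever the
        sign of \<open>lam\<close>.\<close>
      have "0 \<le> (norm ((2 * lam) *\<^sub>R v x + w x))\<^sup>2" by simp
      then show "- 2 * lam * (v x \<bullet> w x) \<le> 2 * lam\<^sup>2 * (norm (v x))\<^sup>2 + 1/2 * (norm (w x))\<^sup>2"
        unfolding power2_norm_eq_inner by (simp add: inner_simps inner_commute power2_eq_square algebra_simps)
    qed
    also have "\<dots> = ?I (\<lambda>x. 2 * lam\<^sup>2 * (norm (v x))\<^sup>2) + ?I (\<lambda>x. 1/2 * (norm (w x))\<^sup>2)"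
      by (rule Henstock_Kurzweil_Integration.integral_add; intro ic continuous_intros)
    finally show "- 2 * lam * V \<le> 2 * lam\<^sup>2 * E + L / 2" by (simp add: V_def E_def L_def)
  qed

  have RR: "?I (\<lambda>x. v x \<bullet> R x) \<le> b * ?I (\<lambda>x. norm (R x))"
  proof -
    have "?I (\<lambda>x. v x \<bullet> R x) \<le> ?I (\<lambda>x. b * norm (R x))"
      by (intro integral_cell_mono continuous_intros order_trans[OF norm_cauchy_schwarz] mult_right_mono b) auto
    then show ?thesis by simp
  qed

  have "?I (\<lambda>x. v x \<bullet> vt x) = ?I (\<lambda>x. v x \<bullet> R x - (\<Sum>i\<in>UNIV. T i x)
      - (\<Sum>i\<in>UNIV. f i x \<bullet> du i x + f' i x \<bullet> u x) - lam * (v x \<bullet> w x) - (\<Sum>i\<in>UNIV. v x \<bullet> ddw i x))"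
  proof (intro Henstock_Kurzweil_Integration.integral_cong)
    fix x :: "real^'d" assume x: "x \<in> cell"
    have "(\<Sum>i\<in>UNIV. T i x) + (\<Sum>i\<in>UNIV. f i x \<bullet> du i x + f' i x \<bullet> u x)
        = v x \<bullet> ((\<Sum>j\<in>UNIV. v x $ j *\<^sub>R dv j x) + (\<Sum>j\<in>UNIV. u x $ j *\<^sub>R dv j x) + (\<Sum>j\<in>UNIV. v x $ j *\<^sub>R du j x))"
      unfolding T_def f_def inner_sum_right inner_add_right sum.distrib[symmetric]
      by (rule sum.cong) (auto simp: algebra_simps)
    then show "v x \<bullet> vt x = v x \<bullet> R x - (\<Sum>i\<in>UNIV. T i x)
      - (\<Sum>i\<in>UNIV. f i x \<bullet> du i x + f' i x \<bullet> u x) - lam * (v x \<bullet> w x) - (\<Sum>i\<in>UNIV. v x \<bullet> ddw i x)"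
      by (simp add: eq[OF x] inner_diff_right inner_add_right inner_sum_right)
  qed
  also have "\<dots> = ?I (\<lambda>x. v x \<bullet> R x) - ?I (\<lambda>x. \<Sum>i\<in>UNIV. T i x)
      - ?I (\<lambda>x. \<Sum>i\<in>UNIV. f i x \<bullet> du i x + f' i x \<bullet> u x) - lam * V - ?I (\<lambda>x. \<Sum>i\<in>UNIV. v x \<bullet> ddw i x)"
    unfolding V_def
    by (subst Henstock_Kurzweil_Integration.integral_diff, (intro ic continuous_intros)+)+ simp
  finally have tested: "?I (\<lambda>x. v x \<bullet> vt x) = \<dots>" .
  have L0: "0 \<le> L"
    unfolding L_def by (intro Henstock_Kurzweil_Integration.integral_nonneg ic continuous_intros) simp
  from tested have "2 * ?I (\<lambda>x. v x \<bullet> vt x) \<le> 2 * (b * ?I (\<lambda>x. norm (R x)))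
     + (18 * real CARD('d) * (P\<^sup>2 + Q\<^sup>2) * E + (\<Sum>i\<in>UNIV. N i)) + 2 * (2 * a * b * J)
     + (2 * lam\<^sup>2 * E + L / 2) + 2 * (- L + m * J)"
    using bilap trilin advection VE(2) RR by (simp add: algebra_simps)
  \<comment> \<open>Balance of \<open>L\<close>: -2 from the bilaplacian, 1/2 from the
    \<open>lam\<close> term, 1/2 from the gradient, so -1 in total, which is dropped. The
    coefficient of \<open>J\<close> adds b (gradient), 4ab (trilinear term) and 2m
    (bilaplacian).\<close>
  also have "\<dots> \<le> (18 * real CARD('d) * (P\<^sup>2 + Q\<^sup>2) + 1/2 + 2 * lam\<^sup>2) * E
     + 2 * b * ?I (\<lambda>x. norm (R x)) + (b + 4 * a * b + 2 * m) * J"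
    using grad VE(1) L0 by (simp add: algebra_simps)
  finally show ?thesis unfolding E_def J_def j_def .
qed

section \<open>Calculus of partial derivatives within a set\<close>

text \<open>
  One-sided derivatives are unique on such a set, so \<^const>\<open>partial\<close> is additive there.
\<close>

definition thick :: "'a::euclidean_space set \<Rightarrow> bool" where
  "thick S \<longleftrightarrow> (\<forall>z\<in>S. \<forall>b\<in>Basis. at 0 within {h. z + h *\<^sub>R b \<in> S} \<noteq> bot)"

text \<open>The admissible steps from a point form an interval of positive length containing 0, so 0
  is a limit point of them even at the boundary.\<close>

lemma thick_cbox:
  assumes "box p q \<noteq> {}"
  shows "thick (cbox p q)"
  unfolding thick_def
proof (intro ballI)
  fix z b :: 'a assume z: "z \<in> cbox p q" and b: "b \<in> Basis"
  have pq: "p \<bullet> c < q \<bullet> c" if "c \<in> Basis" for c using assms that by (auto simp: box_ne_empty)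
  have "z \<bullet> c + h * (b \<bullet> c) = (if c = b then z \<bullet> b + h else z \<bullet> c)" if "c \<in> Basis" for c h
    using b that by (auto simp: inner_Basis)
  then have "{h. z + h *\<^sub>R b \<in> cbox p q} = {p \<bullet> b - z \<bullet> b .. q \<bullet> b - z \<bullet> b}"
    using z b by (auto simp: mem_box inner_add_left)
  moreover have "0 islimpt {p \<bullet> b - z \<bullet> b .. q \<bullet> b - z \<bullet> b}"
    using pq[OF b] z b by (subst islimpt_Icc) (auto simp: mem_box)
  ultimately show "at 0 within {h. z + h *\<^sub>R b \<in> cbox p q} \<noteq> bot"
    by (simp add: trivial_limit_within)
qed

lemma has_vector_derivative_partial:
  assumes "Ck_on (Suc k) S f" "z \<in> S" "b \<in> Basis"
  shows "((\<lambda>h. f (z + h *\<^sub>R b)) has_vector_derivative partial S b f z) (at 0 within {h. z + h *\<^sub>R b \<in> S})"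
  using assms unfolding partial_def by (simp add: vector_derivative_works[symmetric])

lemma partial_eqI:
  assumes "thick S" "z \<in> S" "b \<in> Basis"
    "((\<lambda>h. f (z + h *\<^sub>R b)) has_vector_derivative D) (at 0 within {h. z + h *\<^sub>R b \<in> S})"
  shows "partial S b f z = D"
  using assms unfolding partial_def thick_def by (auto intro!: vector_derivative_within)

text \<open>\<open>vector_derivative\<close> selects from a predicate that sees only the values on
  \<open>S\<close>; equal predicates give equal selections, whether or not a derivative
  exists.\<close>

lemma partial_cong:
  assumes eq: "\<And>z. z \<in> S \<Longrightarrow> f z = g z" and z: "z \<in> S"
  shows "partial S b f z = partial S b g z"
proof -
  let ?H = "{h. z + h *\<^sub>R b \<in> S}"
  have "((\<lambda>h. f (z + h *\<^sub>R b)) has_vector_derivative D) (at 0 within ?H) \<longleftrightarrow>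
        ((\<lambda>h. g (z + h *\<^sub>R b)) has_vector_derivative D) (at 0 within ?H)" for D
    using eq z by (auto elim!: has_vector_derivative_transform[rotated 2])
  then show ?thesis by (simp add: partial_def vector_derivative_def)
qed

text \<open>Identities such as \<open>partial_diff\<close> hold only on \<open>S\<close>, so
  derivatives inside \<open>Ck_on\<close> must be exchanged by agreement on \<open>S\<close> instead
  of equality of functions.\<close>

lemma Ck_on_cong:
  assumes "Ck_on k S f" "\<And>z. z \<in> S \<Longrightarrow> f z = g z"
  shows "Ck_on k S g"
  using assms
proof (induction k arbitrary: f g)
  case 0
  then show ?case by (metis Ck_on.simps(1) continuous_on_cong)
next
  case (Suc k)
  show ?case unfolding Ck_on.simps
  proof (intro conjI ballI)
    show "continuous_on S g" using Suc.prems by (metis Ck_on.simps(2) continuous_on_cong)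
    fix b :: 'a assume b: "b \<in> Basis"
    show "Ck_on k S (partial S b g)"
    proof (rule Suc.IH)
      show "Ck_on k S (partial S b f)" using Suc.prems b by simp
    qed (rule partial_cong[OF Suc.prems(2)])
    fix z assume z: "z \<in> S"
    have "(\<lambda>h. f (z + h *\<^sub>R b)) differentiable (at 0 within {h. z + h *\<^sub>R b \<in> S})"
      using Suc.prems b z by simp
    then show "(\<lambda>h. g (z + h *\<^sub>R b)) differentiable (at 0 within {h. z + h *\<^sub>R b \<in> S})"
      unfolding differentiable_def
      using has_derivative_transform[of 0 "{h. z + h *\<^sub>R b \<in> S}" "\<lambda>h. g (z + h *\<^sub>R b)" "\<lambda>h. f (z + h *\<^sub>R b)"]
        Suc.prems(2) z by auto
  qed
qed

lemma Ck_on_continuous: "Ck_on k S f \<Longrightarrow> continuous_on S f"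
  by (cases k) auto

lemma Ck_on_Suc: "Ck_on (Suc k) S f \<Longrightarrow> Ck_on k S f"
proof (induction k arbitrary: f)
  case (Suc k)
  then show ?case unfolding Ck_on.simps(2)[of "Suc k"] Ck_on.simps(2)[of k] by blast
qed simp

lemma Ck_on_le: "Ck_on m S f \<Longrightarrow> k \<le> m \<Longrightarrow> Ck_on k S f"
  by (induction m) (auto simp: le_Suc_eq simp del: Ck_on.simps dest: Ck_on_Suc)

lemma Ck_on_partial: "Ck_on (Suc k) S f \<Longrightarrow> b \<in> Basis \<Longrightarrow> Ck_on k S (partial S b f)"
  by simp

lemma partial_diff:
  assumes "thick S" "Ck_on (Suc k) S f" "Ck_on (Suc k) S g" "z \<in> S" "b \<in> Basis"
  shows "partial S b (\<lambda>z. f z - g z) z = partial S b f z - partial S b g z"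
  using assms by (intro partial_eqI has_vector_derivative_diff has_vector_derivative_partial)

lemma partial_sum:
  assumes "thick S" "\<And>i. i \<in> A \<Longrightarrow> Ck_on (Suc k) S (f i)" "z \<in> S" "b \<in> Basis"
  shows "partial S b (\<lambda>z. \<Sum>i\<in>A. f i z) z = (\<Sum>i\<in>A. partial S b (f i) z)"
  using assms by (intro partial_eqI has_vector_derivative_sum has_vector_derivative_partial)

lemma Ck_on_diff:
  assumes "thick S" "Ck_on k S f" "Ck_on k S g"
  shows "Ck_on k S (\<lambda>z. f z - g z)"
  using assms(2,3)
proof (induction k arbitrary: f g)
  case 0
  then show ?case by (simp add: continuous_on_diff)
next
  case (Suc k)
  show ?case unfolding Ck_on.simps
  proof (intro conjI ballI)
    show "continuous_on S (\<lambda>z. f z - g z)" using Suc.prems by (simp add: continuous_on_diff)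
    fix b :: 'a assume b: "b \<in> Basis"
    have "Ck_on k S (\<lambda>z. partial S b f z - partial S b g z)"
      using Suc b by simp
    then show "Ck_on k S (partial S b (\<lambda>z. f z - g z))"
      by (rule Ck_on_cong) (rule partial_diff[OF assms(1) Suc.prems _ b, symmetric])
    show "(\<lambda>h. f (z + h *\<^sub>R b) - g (z + h *\<^sub>R b)) differentiable (at 0 within {h. z + h *\<^sub>R b \<in> S})"
      if "z \<in> S" for z using Suc.prems b that by (intro differentiable_diff) auto
  qed
qed

lemma Ck_on_sum:
  assumes "thick S" "finite A" "\<And>i. i \<in> A \<Longrightarrow> Ck_on k S (f i)"
  shows "Ck_on k S (\<lambda>z. \<Sum>i\<in>A. f i z)"
  using assms(3)
proof (induction k arbitrary: f)
  case 0
  then show ?case by (simp add: continuous_on_sum)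
next
  case (Suc k)
  show ?case unfolding Ck_on.simps
  proof (intro conjI ballI)
    show "continuous_on S (\<lambda>z. \<Sum>i\<in>A. f i z)" using Suc.prems by (simp add: continuous_on_sum)
    fix b :: 'a assume b: "b \<in> Basis"
    have "Ck_on k S (\<lambda>z. \<Sum>i\<in>A. partial S b (f i) z)"
      using Suc b by simp
    then show "Ck_on k S (partial S b (\<lambda>z. \<Sum>i\<in>A. f i z))"
      by (rule Ck_on_cong) (rule partial_sum[OF assms(1) Suc.prems _ b, symmetric])
    show "(\<lambda>h. \<Sum>i\<in>A. f i (z + h *\<^sub>R b)) differentiable (at 0 within {h. z + h *\<^sub>R b \<in> S})"
      if "z \<in> S" for z using Suc.prems b that assms(2) by (intro differentiable_sum) auto
  qed
qed

lemma Ck_on_partials: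
  "Ck_on (k + length bs) S f \<Longrightarrow> set bs \<subseteq> Basis \<Longrightarrow> Ck_on k S (partials S bs f)"
  by (induction bs arbitrary: k) (auto simp: partials_def simp del: Ck_on.simps intro: Ck_on_partial)

text \<open>The supremum in \<open>Ck_norm\<close> is meaningful only if bounded above: there are
  finitely many multi-indices, and each derivative is continuous on a compact set.\<close>

lemma norm_partials_le:
  fixes S :: "'a::euclidean_space set"
  assumes f: "Ck_on k S f" and S: "compact S" and bs: "bs \<in> multi_indices k" and z: "z \<in> S"
  shows "norm (partials S bs f z) \<le> Ck_norm k S f"
proof -
  let ?n = "\<lambda>(bs, z). norm (partials S bs f z)"
  have fin: "finite (multi_indices k :: 'a list set)"
    unfolding multi_indices_def by (rule finite_lists_length_le) simp
  have "bounded ((\<lambda>z. partials S cs f z) ` S)" if "cs \<in> multi_indices k" for cs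
  proof -
    have "Ck_on (k - length cs) S (partials S cs f)"
      using that f by (intro Ck_on_partials) (auto simp: multi_indices_def)
    then show ?thesis
      using S by (intro compact_imp_bounded compact_continuous_image Ck_on_continuous)
  qed
  then have "\<forall>cs\<in>multi_indices k. \<exists>B. \<forall>z\<in>S. norm (partials S cs f z) \<le> B"
    by (simp add: bounded_iff)
  then obtain B where B: "\<And>cs z. cs \<in> multi_indices k \<Longrightarrow> z \<in> S \<Longrightarrow> norm (partials S cs f z) \<le> B cs"
    by metis
  have "bdd_above (?n ` (multi_indices k \<times> S))"
  proof (rule bdd_aboveI2)
    fix p :: "'a list \<times> 'a" assume "p \<in> multi_indices k \<times> S"
    then obtain cs z where p: "p = (cs, z)" "cs \<in> multi_indices k" "z \<in> S" by auto
    have "B cs \<le> Max (B ` multi_indices k)" using fin p by (intro Max_ge) auto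
    then show "?n p \<le> Max (B ` multi_indices k)" using B[OF p(2,3)] by (simp add: p(1))
  qed
  then have "?n (bs, z) \<le> Ck_norm k S f"
    unfolding Ck_norm_def using bs z by (intro cSUP_upper) auto
  then show ?thesis by simp
qed

text \<open>\<open>partial\<close> differentiates at step 0 from each point; the shift
  \<open>q - r\<close> turns this into a derivative at every parameter of a fixed line.\<close>

lemma has_vector_derivative_line:
  assumes f: "Ck_on (Suc k) S f" and b: "b \<in> Basis" and X: "\<And>r. r \<in> X \<Longrightarrow> p + r *\<^sub>R b \<in> S" and r: "r \<in> X"
  shows "((\<lambda>r. f (p + r *\<^sub>R b)) has_vector_derivative partial S b f (p + r *\<^sub>R b)) (at r within X)"
proof -
  let ?z = "p + r *\<^sub>R b"
  have "((\<lambda>h. f (?z + h *\<^sub>R b)) has_vector_derivative partial S b f ?z) (at 0 within {h. ?z + h *\<^sub>R b \<in> S})"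
    by (rule has_vector_derivative_partial[OF f X[OF r] b])
  then have "((\<lambda>h. f (?z + h *\<^sub>R b)) has_vector_derivative partial S b f ?z) (at (r - r) within (\<lambda>q. q - r) ` X)"
    using X by (auto simp: algebra_simps elim!: has_vector_derivative_within_subset)
  moreover have "((\<lambda>q. q - r) has_vector_derivative 1) (at r within X)"
    by (auto intro!: derivative_eq_intros)
  ultimately have "((\<lambda>h. f (?z + h *\<^sub>R b)) \<circ> (\<lambda>q. q - r) has_vector_derivative 1 *\<^sub>R partial S b f ?z) (at r within X)"
    by (intro vector_diff_chain_within)
  then show ?thesis by (simp add: comp_def algebra_simps)
qed

declare Ck_on.simps(2) [simp del]

section \<open>Coordinate derivatives on the space-time cylinder\<close>

lemma cyl_cbox: "cyl T = cbox (0, 0) (\<chi> i. 2, T)"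
  by (simp add: cyl_def cell_def cbox_Pair_eq)

lemma mem_cyl: "(x, t) \<in> cyl T \<longleftrightarrow> x \<in> cell \<and> 0 \<le> t \<and> t \<le> T"
  by (auto simp: cyl_def)

lemma compact_cyl: "compact (cyl T)"
  by (simp add: cyl_cbox)

lemma thick_cyl: "T > 0 \<Longrightarrow> thick (cyl T :: ((real^'d::finite) \<times> real) set)"
  unfolding cyl_cbox
  by (intro thick_cbox) (auto simp: box_ne_empty Basis_prod_def Basis_vec_def inner_axis)

lemma Basis_space [simp]: "(axis i 1, 0) \<in> (Basis :: ((real^'d::finite) \<times> real) set)"
  by (auto simp: Basis_prod_def Basis_vec_def)

lemma Basis_time [simp]: "(0, 1) \<in> (Basis :: ((real^'d::finite) \<times> real) set)"
  by (auto simp: Basis_prod_def)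

lemma Ck_on_dx: "Ck_on (Suc k) (cyl T) f \<Longrightarrow> Ck_on k (cyl T) (dx T i f)"
  unfolding dx_def by (intro Ck_on_partial) auto

lemma Ck_on_dt: "Ck_on (Suc k) (cyl T) f \<Longrightarrow> Ck_on k (cyl T) (dt T f)"
  unfolding dt_def by (intro Ck_on_partial) auto

lemma Ck_on_laplace:
  assumes "T > 0" "Ck_on (Suc (Suc k)) (cyl T) f"
  shows "Ck_on k (cyl T) (laplace T f)"
  unfolding laplace_def using assms by (intro Ck_on_sum thick_cyl Ck_on_dx) auto

lemma continuous_on_time_slice:
  "continuous_on (cyl T) f \<Longrightarrow> t \<in> {0..T} \<Longrightarrow> continuous_on cell (\<lambda>x. f (x, t))"
  by (rule continuous_on_compose2) (auto simp: mem_cyl intro!: continuous_intros)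

lemma has_dx_time_slice:
  assumes f: "Ck_on (Suc k) (cyl T) f" and t: "t \<in> {0..T}"
  shows "has_dx i (\<lambda>x. f (x, t)) (\<lambda>x. dx T i f (x, t))"
  unfolding has_dx_def
proof (intro conjI ballI)
  show "continuous_on cell (\<lambda>x. f (x, t))" "continuous_on cell (\<lambda>x. dx T i f (x, t))"
    by (rule continuous_on_time_slice[OF Ck_on_continuous[OF f] t])
      (rule continuous_on_time_slice[OF Ck_on_continuous[OF Ck_on_dx[OF f]] t])
  fix x :: "real^'a" and r :: real assume x: "x \<in> cell" and r: "r \<in> {0..2}"
  \<comment> \<open>Starting the line on the face where coordinate i is 0 makes the parameter the
    i-th coordinate itself, as \<open>has_dx\<close> demands.\<close>
  have eq: "(upd i 0 x, t) + q *\<^sub>R (axis i 1, 0) = (upd i q x, t)" for q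
    by (simp add: vec_eq_iff axis_def)
  have "((\<lambda>r. f ((upd i 0 x, t) + r *\<^sub>R (axis i 1, 0))) has_vector_derivative
      partial (cyl T) (axis i 1, 0) f ((upd i 0 x, t) + r *\<^sub>R (axis i 1, 0))) (at r within {0..2})"
  proof (rule has_vector_derivative_line[OF f])
    show "(upd i 0 x, t) + q *\<^sub>R (axis i 1, 0) \<in> cyl T" if "q \<in> {0..2}" for q
      unfolding eq using that x t by (simp add: mem_cyl upd_in_cell)
  qed (use r in auto)
  then show "((\<lambda>r. f (upd i r x, t)) has_vector_derivative dx T i f (upd i r x, t)) (at r within {0..2})"
    unfolding eq dx_def .
qed

lemma has_vector_derivative_dt:
  assumes f: "Ck_on (Suc k) (cyl T) f" and x: "x \<in> cell" and t: "t \<in> {0..T}"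
  shows "((\<lambda>t. f (x, t)) has_vector_derivative dt T f (x, t)) (at t within {0..T})"
proof -
  have "((\<lambda>t. f ((x, 0) + t *\<^sub>R (0, 1))) has_vector_derivative
      partial (cyl T) (0, 1) f ((x, 0) + t *\<^sub>R (0, 1))) (at t within {0..T})"
    by (rule has_vector_derivative_line[OF f]) (use x t in \<open>auto simp: mem_cyl\<close>)
  then show ?thesis by (simp add: dt_def)
qed


lemma dx_diff:
  assumes T: "T > 0" and "Ck_on (Suc k) (cyl T) f" "Ck_on (Suc k) (cyl T) g" "z \<in> cyl T"
  shows "dx T i (\<lambda>z. f z - g z) z = dx T i f z - dx T i g z"
  unfolding dx_def by (rule partial_diff[OF thick_cyl[OF T] assms(2-4) Basis_space])

lemma dt_diff:
  assumes T: "T > 0" and "Ck_on (Suc k) (cyl T) f" "Ck_on (Suc k) (cyl T) g" "z \<in> cyl T"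
  shows "dt T (\<lambda>z. f z - g z) z = dt T f z - dt T g z"
  unfolding dt_def by (rule partial_diff[OF thick_cyl[OF T] assms(2-4) Basis_time])

lemma dx_cong:
  "(\<And>z. z \<in> cyl T \<Longrightarrow> f z = g z) \<Longrightarrow> z \<in> cyl T \<Longrightarrow> dx T i f z = dx T i g z"
  unfolding dx_def by (rule partial_cong)

lemma laplace_cong:
  "(\<And>z. z \<in> cyl T \<Longrightarrow> f z = g z) \<Longrightarrow> z \<in> cyl T \<Longrightarrow> laplace T f z = laplace T g z"
  unfolding laplace_def by (intro sum.cong refl dx_cong)

lemma laplace_diff:
  assumes T: "T > 0" and f: "Ck_on (Suc (Suc k)) (cyl T) f" and g: "Ck_on (Suc (Suc k)) (cyl T) g" and z: "z \<in> cyl T"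
  shows "laplace T (\<lambda>z. f z - g z) z = laplace T f z - laplace T g z"
proof -
  have "dx T i (dx T i (\<lambda>z. f z - g z)) z = dx T i (dx T i f) z - dx T i (dx T i g) z" for i
  proof -
    have "dx T i (dx T i (\<lambda>z. f z - g z)) z = dx T i (\<lambda>z. dx T i f z - dx T i g z) z"
      by (intro dx_cong dx_diff[OF T f g] z)
    also have "\<dots> = dx T i (dx T i f) z - dx T i (dx T i g) z"
      by (rule dx_diff[OF T Ck_on_dx[OF f] Ck_on_dx[OF g] z])
    finally show ?thesis .
  qed
  then show ?thesis by (simp add: laplace_def sum_subtractf)
qed

abbreviation "ex i \<equiv> (axis i 1, 0) :: (real^'d::finite) \<times> real"

lemma laplace_partials: "laplace T f z = (\<Sum>j\<in>UNIV. partials (cyl T) [ex j, ex j] f z)"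
  by (simp add: laplace_def dx_def partials_def)

text \<open>Multi-indices are the form in which both \<open>Ck_norm\<close> and
  \<open>cell_periodic\<close> are stated, so bounds and periodicity of third derivatives are read
  off from here.\<close>

lemma dx_laplace_partials:
  assumes "T > 0" "Ck_on 4 (cyl T) f" "z \<in> cyl T"
  shows "dx T i (laplace T f) z = (\<Sum>j\<in>UNIV. partials (cyl T) [ex i, ex j, ex j] f z)"
proof -
  have "Ck_on (Suc 0) (cyl T) (dx T j (dx T j f))" for j
    by (intro Ck_on_dx, rule Ck_on_le[OF assms(2)]) simp
  then have "dx T i (laplace T f) z = (\<Sum>j\<in>UNIV. dx T i (dx T j (dx T j f)) z)"
    unfolding laplace_def dx_def
    by (intro partial_sum[OF thick_cyl[OF assms(1)] _ assms(3) Basis_space])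
  then show ?thesis by (simp add: dx_def partials_def)
qed

section \<open>Pointwise bounds and periodicity from multi-indices\<close>

context
  fixes T :: real and f :: "'d::finite field"
  assumes T: "T > 0" and f: "Ck_on 4 (cyl T) f"
begin

lemma norm_le_Ck_norm:
  assumes "z \<in> cyl T"
  shows "norm (f z) \<le> Ck_norm 4 (cyl T) f" "norm (dx T i f z) \<le> Ck_norm 4 (cyl T) f"
  using norm_partials_le[OF f compact_cyl _ assms, of "[]"] norm_partials_le[OF f compact_cyl _ assms, of "[ex i]"]
  by (simp_all add: partials_def dx_def multi_indices_def)

lemma norm_laplace_le:
  assumes "z \<in> cyl T"
  shows "norm (laplace T f z) \<le> real CARD('d) * Ck_norm 4 (cyl T) f"
    and "norm (dx T i (laplace T f) z) \<le> real CARD('d) * Ck_norm 4 (cyl T) f"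
proof -
  have "norm (\<Sum>j\<in>UNIV. partials (cyl T) (bs j) f z) \<le> (\<Sum>j\<in>(UNIV::'d set). Ck_norm 4 (cyl T) f)"
    if "\<And>j. bs j \<in> multi_indices 4" for bs :: "'d \<Rightarrow> ((real^'d) \<times> real) list"
    by (intro sum_norm_le norm_partials_le[OF f compact_cyl _ assms] that)
  from this[of "\<lambda>j. [ex j, ex j]"] this[of "\<lambda>j. [ex i, ex j, ex j]"]
  show "norm (laplace T f z) \<le> real CARD('d) * Ck_norm 4 (cyl T) f"
    "norm (dx T i (laplace T f) z) \<le> real CARD('d) * Ck_norm 4 (cyl T) f"
    unfolding laplace_partials dx_laplace_partials[OF T f assms]
    by (simp_all add: multi_indices_def)
qed

lemma periodic_partials:
  assumes "cell_periodic T f" "x \<in> cell" "t \<in> {0..T}" "bs \<in> multi_indices 4"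
  shows "partials (cyl T) bs f (upd i 2 x, t) = partials (cyl T) bs f (upd i 0 x, t)"
proof -
  have "opposite i 2 (upd i 2 x) = upd i 0 x"
    by (simp add: opposite_def normal_vec_def vec_eq_iff axis_def)
  then show ?thesis
    using assms(1)[unfolded cell_periodic_def, rule_format, OF assms(4) _ upd_in_face[OF assms(2)] assms(3), of 2 i]
    by simp
qed

lemma periodic:
  assumes "cell_periodic T f" "x \<in> cell" "t \<in> {0..T}"
  shows "f (upd i 2 x, t) = f (upd i 0 x, t)"
    and "dx T j f (upd i 2 x, t) = dx T j f (upd i 0 x, t)"
    and "laplace T f (upd i 2 x, t) = laplace T f (upd i 0 x, t)"
    and "dx T j (laplace T f) (upd i 2 x, t) = dx T j (laplace T f) (upd i 0 x, t)"
proof -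
  have c: "(upd i 2 x, t) \<in> cyl T" "(upd i 0 x, t) \<in> cyl T"
    using assms by (auto simp: mem_cyl upd_in_cell)
  note p = periodic_partials[OF assms]
  show "f (upd i 2 x, t) = f (upd i 0 x, t)" "dx T j f (upd i 2 x, t) = dx T j f (upd i 0 x, t)"
    using p[of "[]" i] p[of "[ex j]" i] by (simp_all add: partials_def dx_def multi_indices_def)
  show "laplace T f (upd i 2 x, t) = laplace T f (upd i 0 x, t)"
    unfolding laplace_partials by (intro sum.cong refl p) (simp add: multi_indices_def)
  show "dx T j (laplace T f) (upd i 2 x, t) = dx T j (laplace T f) (upd i 0 x, t)"
    unfolding dx_laplace_partials[OF T f c(1)] dx_laplace_partials[OF T f c(2)]
    by (intro sum.cong refl p) (simp add: multi_indices_def)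
qed

end

text \<open>Opposite faces carry the same jumps up to sign, so it suffices to work on the faces with
  s = 2, whose outer normal is +e_i.\<close>

lemma dn_2: "dn T i 2 f = dx T i f"
  unfolding dn_def normal_vec_def
  by (rule ext) (simp add: axis_def if_distrib[of "\<lambda>c. c *\<^sub>R _"] cong: if_cong)

lemma jump_upd_2: "jump i 2 g (upd i 2 x, t) = g (upd i 2 x, t) - g (upd i 0 x, t)"
proof -
  have "opposite i 2 (upd i 2 x) = upd i 0 x"
    by (simp add: opposite_def normal_vec_def vec_eq_iff axis_def)
  then show ?thesis by (simp add: jump_def)
qed

section \<open>Integration in time and Lebesgue norms\<close>

text \<open>Formulated for the running integral G of \<open>E\<close>, since the target norm is
  itself an integral over time. From G' <= \<beta> + A G and exp (-A t) <= 1, the function exp (-A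
  t) G - \<beta> t is nonincreasing, and it vanishes at 0.\<close>

lemma gronwall_integral:
  fixes E :: "real \<Rightarrow> real"
  assumes E: "continuous_on {0..T} E" and T: "T > 0" and \<beta>: "\<beta> \<ge> 0" and A: "A \<ge> 0"
    and le: "\<And>t. t \<in> {0..T} \<Longrightarrow> E t \<le> \<beta> + A * integral {0..t} E"
  shows "integral {0..T} E \<le> \<beta> * T * exp (A * T)"
proof -
  define G where "G t = integral {0..t} E" for t
  define F where "F t = exp (- (A * t)) * G t - \<beta> * t" for t
  have G: "(G has_real_derivative E t) (at t within {0..T})" if "t \<in> {0..T}" for t
    unfolding G_def[abs_def] by (rule integral_has_real_derivative[OF E that])
  have "F T \<le> F 0"
  proof (rule DERIV_nonpos_imp_decreasing_open[where f = F])
    fix t assume t: "0 < t" "t < T"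
    have "(G has_real_derivative E t) (at t)"
      using G[of t] t by (simp add: at_within_Icc_at)
    then have "(F has_real_derivative exp (- (A * t)) * (E t - A * G t) - \<beta>) (at t)"
      unfolding F_def[abs_def] by (auto intro!: derivative_eq_intros simp: algebra_simps)
    moreover have "exp (- (A * t)) * (E t - A * G t) \<le> 1 * \<beta>"
    proof -
      have "exp (- (A * t)) * (E t - A * G t) \<le> exp (- (A * t)) * \<beta>"
        using le[of t] t by (intro mult_left_mono) (auto simp: G_def)
      also have "\<dots> \<le> 1 * \<beta>" using A \<beta> t by (intro mult_right_mono) auto
      finally show ?thesis .
    qed
    ultimately show "\<exists>y. (F has_real_derivative y) (at t) \<and> y \<le> 0"
      by (intro exI[of _ "exp (- (A * t)) * (E t - A * G t) - \<beta>"]) auto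
  next
    have "continuous_on {0..T} G"
      unfolding continuous_on_eq_continuous_within using DERIV_continuous[OF G] by blast
    then show "continuous_on {0..T} F" unfolding F_def[abs_def] by (intro continuous_intros)
  qed (use T in auto)
  then have "exp (- (A * T)) * G T \<le> \<beta> * T" by (simp add: F_def G_def)
  then have "G T / exp (A * T) \<le> \<beta> * T" by (simp add: exp_minus divide_inverse mult.commute)
  then show ?thesis by (simp add: G_def pos_divide_le_eq)
qed

text \<open>Cauchy-Schwarz against the constant 1, obtained as nonnegativity of the variance:
  \<open>c\<close> is the mean value of \<open>f\<close>.\<close>

lemma integral_le_sqrt:
  fixes f :: "'a::euclidean_space \<Rightarrow> real"
  assumes f: "continuous_on (cbox a b) f"
  shows "integral (cbox a b) f \<le> sqrt (measure lborel (cbox a b)) * sqrt (integral (cbox a b) (\<lambda>x. (f x)\<^sup>2))"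
proof (cases "measure lborel (cbox a b) = 0")
  case True
  then show ?thesis by (simp add: integral_null)
next
  case False
  let ?V = "measure lborel (cbox a b)" and ?I = "integral (cbox a b) f" and ?Q = "integral (cbox a b) (\<lambda>x. (f x)\<^sup>2)"
  have V: "?V > 0" using False by (simp add: less_le)
  define c where "c = ?I / ?V"
  have "0 \<le> integral (cbox a b) (\<lambda>x. (f x - c)\<^sup>2)"
    by (intro Henstock_Kurzweil_Integration.integral_nonneg integrable_continuous continuous_intros f) simp
  also have "\<dots> = integral (cbox a b) (\<lambda>x. (f x)\<^sup>2 - (2 * c * f x - c\<^sup>2))"
    by (simp add: power2_eq_square algebra_simps)
  also have "\<dots> = ?Q - (2 * c * ?I - c\<^sup>2 * ?V)"
    by (subst Henstock_Kurzweil_Integration.integral_diff, (intro integrable_continuous continuous_intros f)+)+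
      (simp add: mult.commute)
  also have "\<dots> = ?Q - ?I\<^sup>2 / ?V"
    using V by (simp add: c_def power2_eq_square field_simps)
  finally have "?I\<^sup>2 \<le> ?V * ?Q" using V by (simp add: field_simps)
  then have "?I \<le> sqrt (?V * ?Q)" by (rule real_le_rsqrt)
  then show ?thesis by (simp add: real_sqrt_mult)
qed

section \<open>Norms on the cell and on the cylinder\<close>

lemma content_cell: "measure lborel (cell :: (real^'d::finite) set) = 2 ^ CARD('d)"
  unfolding cell_def by (subst content_cbox_cart) (auto simp: interval_ne_empty_cart)

lemma content_cyl: "T > 0 \<Longrightarrow> measure lborel (cyl T :: ((real^'d::finite) \<times> real) set) = 2 ^ CARD('d) * T"
  unfolding cyl_cbox content_Pair using content_cell[where 'd='d] by (simp add: cell_def)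

lemma integral_cyl:
  fixes g :: "(real^'d::finite) \<times> real \<Rightarrow> real"
  assumes g: "continuous_on (cyl T) g"
  shows "integral {0..T} (\<lambda>t. integral cell (\<lambda>x. g (x, t))) = integral (cyl T) g"
    and "continuous_on {0..T} (\<lambda>t. integral cell (\<lambda>x. g (x, t)))"
proof -
  have g': "continuous_on (cbox (0 :: real^'d, 0) (\<chi> i. 2, T)) (\<lambda>(x, t). g (x, t))"
    using g by (simp add: cyl_cbox)
  show "integral {0..T} (\<lambda>t. integral cell (\<lambda>x. g (x, t))) = integral (cyl T) g"
    using integral_swap_continuous[OF g'] integral_prod_continuous[OF g'] by (simp add: cyl_cbox cell_def)
  show "continuous_on {0..T} (\<lambda>t. integral cell (\<lambda>x. g (x, t)))"
    unfolding cell_def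
    by (rule integral_continuous_on_param, unfold case_prod_beta, rule continuous_on_compose2[OF g])
      (auto intro!: continuous_intros simp: cell_def[symmetric] mem_cyl)
qed

lemma L2_norm_cell:
  assumes "continuous_on cell (f :: real^'d::finite \<Rightarrow> 'b::real_normed_vector)"
  shows "(L2_norm (restrict_space lborel cell) f)\<^sup>2 = integral cell (\<lambda>x. (norm (f x))\<^sup>2)"
proof -
  have c: "continuous_on cell (\<lambda>x. (norm (f x))\<^sup>2)" using assms by (intro continuous_intros)
  have "0 \<le> integral cell (\<lambda>x. (norm (f x))\<^sup>2)"
    by (intro Henstock_Kurzweil_Integration.integral_nonneg integrable_cell c) simp
  then show ?thesis unfolding L2_norm_def integral_cell_lborel(2)[OF c] by simp
qed

lemma L2_norm_cyl:
  assumes "continuous_on (cyl T) (f :: (real^'d::finite) \<times> real \<Rightarrow> 'b::real_normed_vector)"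
  shows "L2_norm (restrict_space lborel (cyl T)) f = sqrt (integral (cyl T) (\<lambda>z. (norm (f z))\<^sup>2))"
    and "(L2_norm (restrict_space lborel (cyl T)) f)\<^sup>2 = integral (cyl T) (\<lambda>z. (norm (f z))\<^sup>2)"
proof -
  have c: "continuous_on (cyl T) (\<lambda>z. (norm (f z))\<^sup>2)" using assms by (intro continuous_intros)
  have m: "cyl T \<inter> space lborel \<in> sets (lborel :: ((real^'d) \<times> real) measure)"
    by (simp add: cyl_cbox)
  have "set_integrable lborel (cyl T) (\<lambda>z. (norm (f z))\<^sup>2)"
    unfolding set_integrable_def using borel_integrable_compact[OF compact_cyl c]
    by (simp add: indicator_def if_distrib[of "\<lambda>c. c *\<^sub>R _"] cong: if_cong)
  from set_borel_integral_eq_integral(2)[OF this]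
  have "(\<integral>z. (norm (f z))\<^sup>2 \<partial>restrict_space lborel (cyl T)) = integral (cyl T) (\<lambda>z. (norm (f z))\<^sup>2)"
    unfolding integral_restrict_space[OF m] set_lebesgue_integral_def .
  then show e: "L2_norm (restrict_space lborel (cyl T)) f = sqrt (integral (cyl T) (\<lambda>z. (norm (f z))\<^sup>2))"
    by (simp add: L2_norm_def)
  have "0 \<le> integral (cyl T) (\<lambda>z. (norm (f z))\<^sup>2)"
    unfolding cyl_cbox
    by (intro Henstock_Kurzweil_Integration.integral_nonneg integrable_continuous c[unfolded cyl_cbox]) simp
  then show "(L2_norm (restrict_space lborel (cyl T)) f)\<^sup>2 = integral (cyl T) (\<lambda>z. (norm (f z))\<^sup>2)"
    by (simp add: e)
qed

text \<open>For a continuous function an almost-everywhere bound holds at every point, so the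
  essential supremum can serve as a pointwise bound in the energy inequality.\<close>

lemma Linf_norm_cell:
  fixes f :: "real^'d::finite \<Rightarrow> 'b::real_normed_vector"
  assumes f: "continuous_on cell f" and B: "\<And>x. x \<in> cell \<Longrightarrow> norm (f x) \<le> B"
  shows "\<And>x. x \<in> cell \<Longrightarrow> norm (f x) \<le> Linf_norm (restrict_space lborel cell) f"
    and "Linf_norm (restrict_space lborel cell) f \<le> B"
proof -
  let ?D = "restrict_space lborel cell :: (real^'d) measure"
  let ?e = "esssup ?D (\<lambda>x. ereal (norm (f x)))"
  have cell0: "0 \<in> (cell :: (real^'d) set)" by (simp add: mem_cell)
  have B0: "0 \<le> B" using B[OF cell0] norm_ge_zero order_trans by blast
  have nf: "continuous_on cell (\<lambda>x. norm (f x))" using f by (intro continuous_intros)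
  have "(\<lambda>x. norm (f x)) \<in> borel_measurable ?D"
    using integral_cell_lborel(1)[OF nf] by auto
  then have m: "(\<lambda>x. ereal (norm (f x))) \<in> borel_measurable ?D" by simp
  \<comment> \<open>Finiteness matters: \<open>Linf_norm\<close> converts from \<open>ereal\<close>,
    which would turn an infinite essential supremum into 0.\<close>
  have le: "?e \<le> ereal B"
    using B by (intro esssup_I m AE_I2) (auto simp: space_restrict_space)
  show "Linf_norm ?D f \<le> B"
    using le B0 unfolding Linf_norm_def by (cases ?e) auto
  have ae: "AE x in ?D. norm (f x) \<le> Linf_norm ?D f"
    using esssup_AE[of "\<lambda>x. ereal (norm (f x))" ?D]
  proof eventually_elim
    case (elim x)
    then show ?case using le unfolding Linf_norm_def by (cases ?e) auto
  qed
  \<comment> \<open>The excess over the norm is continuous and nonnegative with integral 0, hence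
    vanishes everywhere on the cell.\<close>
  let ?h = "\<lambda>x. max 0 (norm (f x) - Linf_norm ?D f)"
  have hc: "continuous_on cell ?h" using f by (intro continuous_intros)
  have "(\<integral>x. ?h x \<partial>?D) = 0"
    by (rule integral_eq_zero_AE) (use ae in \<open>auto elim!: eventually_mono\<close>)
  then have "integral cell ?h = 0" using integral_cell_lborel(2)[OF hc] by simp
  then have h0: "(?h has_integral 0) cell" using integrable_cell[OF hc] by (simp add: has_integral_integrable_integral)
  fix x :: "real^'d" assume x: "x \<in> cell"
  have "?h x = 0"
  proof (rule has_integral_0_cbox_imp_0[where f = ?h and a = 0 and b = "\<chi> i. 2"])
    show "continuous_on (cbox (0::real^'d) (\<chi> i. 2)) ?h" "(?h has_integral 0) (cbox (0::real^'d) (\<chi> i. 2))"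
      "x \<in> cbox 0 (\<chi> i. 2)"
      using hc h0 x by (simp_all add: cell_def)
    show "box (0::real^'d) (\<chi> i. 2) \<noteq> {}" by (simp add: interval_ne_empty_cart)
  qed simp
  then show "norm (f x) \<le> Linf_norm ?D f" by simp
qed

lemma norm_le_SUP_Linf:
  fixes f :: "'d::finite field"
  assumes f: "continuous_on (cyl T) f" and z: "(x, t) \<in> cyl T"
  shows "norm (f (x, t)) \<le> (SUP t\<in>{0..T}. Linf_norm (restrict_space lborel cell) (\<lambda>x. f (x, t)))"
proof -
  obtain B where B: "\<And>z. z \<in> cyl T \<Longrightarrow> norm (f z) \<le> B"
    using compact_imp_bounded[OF compact_continuous_image[OF f compact_cyl]] by (auto simp: bounded_iff)
  have t: "t \<in> {0..T}" and x: "x \<in> cell" using z by (auto simp: mem_cyl)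
  have c: "continuous_on cell (\<lambda>x. f (x, s))" if "s \<in> {0..T}" for s
    by (rule continuous_on_time_slice[OF f that])
  have Bs: "norm (f (y, s)) \<le> B" if "s \<in> {0..T}" "y \<in> cell" for s y
    using that by (intro B) (simp add: mem_cyl)
  have "norm (f (x, t)) \<le> Linf_norm (restrict_space lborel cell) (\<lambda>x. f (x, t))"
    by (rule Linf_norm_cell(1)[OF c Bs x]) (use t in auto)
  also have "\<dots> \<le> (SUP t\<in>{0..T}. Linf_norm (restrict_space lborel cell) (\<lambda>x. f (x, t)))"
    using t by (intro cSUP_upper bdd_aboveI2[of _ _ B] Linf_norm_cell(2) c Bs) auto
  finally show ?thesis .
qed

text \<open>The fundamental theorem is applied in time at each fixed point and the two integrals are
  swapped, which avoids differentiating under the integral sign.\<close>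

lemma energy_identity:
  fixes v :: "'d::finite field"
  assumes v: "Ck_on (Suc k) (cyl T) v" and t: "t \<in> {0..T}"
  shows "integral cell (\<lambda>x. (norm (v (x, t)))\<^sup>2) - integral cell (\<lambda>x. (norm (v (x, 0)))\<^sup>2)
    = integral {0..t} (\<lambda>s. 2 * integral cell (\<lambda>x. v (x, s) \<bullet> dt T v (x, s)))"
proof -
  have vc: "continuous_on (cyl T) v" and vtc: "continuous_on (cyl T) (dt T v)"
    using Ck_on_continuous[OF v] Ck_on_continuous[OF Ck_on_dt[OF v]] .
  let ?h = "\<lambda>z. 2 * (v z \<bullet> dt T v z)"
  have sub: "cyl t \<subseteq> (cyl T :: ((real^'d) \<times> real) set)" using t by (auto simp: cyl_def)
  have hc: "continuous_on (cyl t) ?h"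
    by (rule continuous_on_subset[OF _ sub]) (intro continuous_intros vc vtc)
  have sq: "continuous_on cell (\<lambda>x. (norm (v (x, s)))\<^sup>2)" if "s \<in> {0..T}" for s
    by (intro continuous_intros continuous_on_time_slice[OF vc that])
  have "integral {0..t} (\<lambda>s. ?h (x, s)) = (norm (v (x, t)))\<^sup>2 - (norm (v (x, 0)))\<^sup>2" if x: "x \<in> cell" for x
  proof (intro integral_unique fundamental_theorem_of_calculus)
    fix s assume s: "s \<in> {0..t}"
    have "((\<lambda>s. v (x, s)) has_vector_derivative dt T v (x, s)) (at s within {0..T})"
      by (rule has_vector_derivative_dt[OF v x]) (use s t in auto)
    then have d: "((\<lambda>s. v (x, s)) has_vector_derivative dt T v (x, s)) (at s within {0..t})"
      by (rule has_vector_derivative_within_subset) (use t in auto)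
    show "((\<lambda>s. (norm (v (x, s)))\<^sup>2) has_vector_derivative ?h (x, s)) (at s within {0..t})"
      unfolding power2_norm_eq_inner
      using bounded_bilinear.has_vector_derivative[OF bounded_bilinear_inner d d]
      by (simp add: inner_commute)
  qed (use t in auto)
  then have "integral cell (\<lambda>x. (norm (v (x, t)))\<^sup>2 - (norm (v (x, 0)))\<^sup>2)
      = integral cell (\<lambda>x. integral {0..t} (\<lambda>s. ?h (x, s)))"
    by (intro Henstock_Kurzweil_Integration.integral_cong) simp
  also have "\<dots> = integral {0..t} (\<lambda>s. integral cell (\<lambda>x. ?h (x, s)))"
    using integral_swap_continuous[of 0 0 "\<chi> i. 2" t "\<lambda>x s. ?h (x, s)"] hc
    by (simp add: cyl_cbox cell_def case_prod_beta')
  finally show ?thesis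
    using t by (subst (asm) Henstock_Kurzweil_Integration.integral_diff) (auto intro!: integrable_cell sq)
qed

lemma continuous_on_jump:
  fixes f :: "'d::finite field"
  assumes "continuous_on (cyl T) f"
  shows "continuous_on (face i 2 \<times> {0..T}) (jump i 2 f)"
proof -
  have "opposite i 2 x = upd i 0 x" if "x \<in> face i 2" for x
    using that by (auto simp: opposite_def normal_vec_def vec_eq_iff axis_def face_def)
  then have "continuous_on (face i 2 \<times> {0..T}) (jump i 2 f) \<longleftrightarrow>
      continuous_on (face i 2 \<times> {0..T}) (\<lambda>z. f (fst z, snd z) - f (upd i 0 (fst z), snd z))"
    by (intro continuous_on_cong) (auto simp: jump_def)
  also have "\<dots>"
    by (intro continuous_on_diff continuous_on_compose2[OF assms])
      (auto intro!: continuous_intros upd_in_cell simp: mem_cyl face_def)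
  finally show ?thesis .
qed

text \<open>Here \<open>f\<close> is a derivative of the error, \<open>h\<close> the same derivative
  of the network and \<open>g\<close> the residual formed from \<open>h\<close>; periodicity of the
  solution provides \<open>eq\<close>. Cauchy-Schwarz on the cylinder passes from the integrated
  jump to its square, which is a face integral of the squared residual.\<close>

lemma jump_integral_time_bound:
  fixes f h :: "'d::finite field" and g :: "'d \<Rightarrow> real \<Rightarrow> 'd field"
  assumes T: "T > 0" and f: "continuous_on (cyl T) f" and h: "continuous_on (cyl T) h"
    and g: "g i 2 = jump i 2 h"
    and eq: "\<And>x t. x \<in> cell \<Longrightarrow> t \<in> {0..T} \<Longrightarrow>
      f (upd i 2 x, t) - f (upd i 0 x, t) = h (upd i 2 x, t) - h (upd i 0 x, t)"
  shows "continuous_on {0..T} (\<lambda>t. jump_integral i (\<lambda>x. f (x, t)))"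
    and "integral {0..T} (\<lambda>t. jump_integral i (\<lambda>x. f (x, t)))
      \<le> sqrt (boundary_area TYPE('d)) * sqrt T * L2_norm_boundary T g"
proof -
  let ?k = "\<lambda>z. norm (f (upd i 2 (fst z), snd z) - f (upd i 0 (fst z), snd z))"
  have kc: "continuous_on (cyl T) ?k"
    by (intro continuous_intros continuous_on_compose2[OF f])
      (auto intro!: continuous_intros upd_in_cell simp: cyl_def)
  note k = integral_cyl[OF kc]
  show "continuous_on {0..T} (\<lambda>t. jump_integral i (\<lambda>x. f (x, t)))"
    unfolding jump_integral_def using k(2) by (intro continuous_intros) auto
  let ?g = "\<lambda>z. (norm (g i 2 z))\<^sup>2"
  let ?F = "\<lambda>i s. \<integral>z. (norm (g i s z))\<^sup>2 \<partial>(face_measure i s \<Otimes>\<^sub>M restrict_space lborel {0..T})"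
  have gc: "continuous_on (face i 2 \<times> {0..T}) ?g"
    unfolding g by (intro continuous_intros continuous_on_jump h)
  have "integral {0..T} (\<lambda>t. integral cell (\<lambda>x. ?g (upd i 2 x, t))) = 2 * ?F i 2"
    by (rule integral_face_time[OF gc]) simp
  moreover have "integral {0..T} (\<lambda>t. integral cell (\<lambda>x. ?g (upd i 2 x, t)))
      = integral {0..T} (\<lambda>t. integral cell (\<lambda>x. (?k (x, t))\<^sup>2))"
    by (intro Henstock_Kurzweil_Integration.integral_cong) (simp add: g jump_upd_2 eq)
  moreover have "\<dots> = integral (cyl T) (\<lambda>z. (?k z)\<^sup>2)"
    by (rule integral_cyl) (intro continuous_intros kc)
  ultimately have kF: "integral (cyl T) (\<lambda>z. (?k z)\<^sup>2) = 2 * ?F i 2" by simp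
  \<comment> \<open>A single face is bounded by the sum over all faces in the boundary norm.\<close>
  have "?F i 2 \<le> (\<Sum>s\<in>{0,2}. ?F i s)"
    by (rule member_le_sum) auto
  also have "\<dots> \<le> (\<Sum>i\<in>UNIV. \<Sum>s\<in>{0,2}. ?F i s)"
    by (rule member_le_sum) (auto intro!: sum_nonneg)
  finally have FL: "sqrt (?F i 2) \<le> L2_norm_boundary T g"
    unfolding L2_norm_boundary_def by (rule real_sqrt_le_mono)
  have "integral {0..T} (\<lambda>t. jump_integral i (\<lambda>x. f (x, t))) = integral (cyl T) ?k / 2"
    unfolding jump_integral_def using k(1) by simp
  also have "\<dots> \<le> sqrt (measure lborel (cyl T :: ((real^'d) \<times> real) set)) * sqrt (2 * ?F i 2) / 2"
    using integral_le_sqrt[OF kc[unfolded cyl_cbox]] kF by (simp add: cyl_cbox)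
  also have "\<dots> = sqrt (2 ^ CARD('d)) * sqrt T * (sqrt 2 / 2 * sqrt (?F i 2))"
    by (simp add: content_cyl[OF T] real_sqrt_mult)
  \<comment> \<open>The volume 2^d from Cauchy-Schwarz is at most the area d 2^d of the boundary,
    and sqrt 2 / 2 is at most 1.\<close>
  also have "\<dots> \<le> sqrt (boundary_area TYPE('d)) * sqrt T * (1 * L2_norm_boundary T g)"
  proof (intro mult_mono FL real_sqrt_le_mono)
    have "1 * 2 ^ CARD('d) \<le> real CARD('d) * 2 ^ CARD('d)"
      by (intro mult_right_mono) (simp_all add: Suc_leI)
    then show "2 ^ CARD('d) \<le> boundary_area TYPE('d)" by (simp add: boundary_area_eq)
    show "sqrt 2 / 2 \<le> (1::real)" using real_sqrt_le_mono[of 2 4] by simp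
  qed (use T FL in \<open>auto simp: boundary_area_eq intro: order_trans[OF real_sqrt_ge_zero]\<close>)
  finally show "integral {0..T} (\<lambda>t. jump_integral i (\<lambda>x. f (x, t)))
      \<le> sqrt (boundary_area TYPE('d)) * sqrt T * L2_norm_boundary T g" by simp
qed

section \<open>The error estimate\<close>

lemma continuous_on_KS_operator:
  assumes T: "T > 0" and f: "Ck_on 4 (cyl T) f"
  shows "continuous_on (cyl T) (KS_operator lam T f)"
proof -
  have k: "Ck_on k (cyl T) f" if "k \<le> 4" for k by (rule Ck_on_le[OF f that])
  have 1: "continuous_on (cyl T) (dt T f)" "continuous_on (cyl T) (dx T i f)" for i
    by (intro Ck_on_continuous[where k = 0] Ck_on_dt Ck_on_dx k; simp)+
  have 2: "continuous_on (cyl T) (laplace T f)" "continuous_on (cyl T) (laplace T (laplace T f))"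
    by (intro Ck_on_continuous[where k = 0] Ck_on_laplace T k; simp)+
  show ?thesis
    unfolding KS_operator_def advect_def
    by (intro continuous_intros 1 2 Ck_on_continuous[OF f])
qed

text \<open>Since 1 - x <= exp (-x). It converts the plain exponential of Gronwall's inequality into
  the form 1 + x exp x of the claimed bound.\<close>

lemma exp_le_one_plus_mult_exp: "exp x \<le> 1 + x * exp (x::real)"
proof -
  have "exp x * (1 - x) \<le> exp x * exp (- x)"
    using exp_ge_add_one_self[of "- x"] by (intro mult_left_mono) auto
  then show ?thesis by (simp add: exp_minus algebra_simps)
qed

text \<open>The bound with every constant explicit, for arbitrary pointwise bounds \<open>P\<close>
  and \<open>Q\<close>, before the factors are merged into \<open>C\<close> and
  \<open>C1\<close>.\<close>

lemma energy_estimate: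
  fixes u us :: "'d::finite field" and lam T :: real
  defines "v \<equiv> \<lambda>z. us z - u z"
  defines "a \<equiv> Ck_norm 4 (cyl T) u" and "b \<equiv> Ck_norm 4 (cyl T) v"
  defines "d \<equiv> real CARD('d)"
  assumes T: "T > 0" and u: "KS_solution lam T u" and us: "Ck_on 4 (cyl T) us"
    and P: "\<And>z. z \<in> cyl T \<Longrightarrow> norm (v z) \<le> P" and Q: "\<And>z. z \<in> cyl T \<Longrightarrow> norm (u z) \<le> Q"
  shows "(L2_norm (restrict_space lborel (cyl T)) v)\<^sup>2 \<le>
    ((L2_norm (restrict_space lborel cell) (R_tb us u))\<^sup>2
      + 2 * b * (sqrt (2 ^ CARD('d)) * sqrt T * L2_norm (restrict_space lborel (cyl T)) (R_PDE lam T us))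
      + (b + 4 * a * b + 2 * (d * b)) * (d * (sqrt (boundary_area TYPE('d)) * sqrt T *
          (L2_norm_boundary T (R_sb1 us) + L2_norm_boundary T (R_sb2 T us)
           + L2_norm_boundary T (R_sb3 T us) + L2_norm_boundary T (R_sb4 T us)))))
    * T * exp ((18 * d * (P\<^sup>2 + Q\<^sup>2) + 1/2 + 2 * lam\<^sup>2) * T)"
    and "a \<ge> 0" "b \<ge> 0"
proof -
  have uC: "Ck_on 4 (cyl T) u" and uper: "cell_periodic T u"
    and uPDE: "\<And>x t. x \<in> cell \<Longrightarrow> 0 < t \<Longrightarrow> t < T \<Longrightarrow> KS_operator lam T u (x, t) = 0"
    using u by (auto simp: KS_solution_def)
  have vC: "Ck_on 4 (cyl T) v" unfolding v_def by (rule Ck_on_diff[OF thick_cyl[OF T] us uC])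
  have le4: "Ck_on k (cyl T) u" "Ck_on k (cyl T) us" "Ck_on k (cyl T) v" if "k \<le> 4" for k
    using Ck_on_le[OF uC that] Ck_on_le[OF us that] Ck_on_le[OF vC that] .
  have S0: "(0, 0) \<in> (cyl T :: ((real^'d) \<times> real) set)" using T by (simp add: mem_cyl mem_cell)
  show a0: "a \<ge> 0" and b0: "b \<ge> 0"
    using norm_le_Ck_norm(1)[OF T uC S0] norm_le_Ck_norm(1)[OF T vC S0] unfolding a_def b_def
    by (meson norm_ge_zero order_trans)+
  have d1: "d \<ge> 1" by (simp add: d_def Suc_leI)

  define w where "w = laplace T v"
  define R where "R = R_PDE lam T us"
  have wC: "Ck_on 2 (cyl T) w" and lusC: "Ck_on 2 (cyl T) (laplace T us)" and luC: "Ck_on 2 (cyl T) (laplace T u)"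
    unfolding w_def by (intro Ck_on_laplace T le4; simp)+
  have Rc: "continuous_on (cyl T) R" unfolding R_def R_PDE_def by (rule continuous_on_KS_operator[OF T us])
  have vc: "continuous_on (cyl T) v" by (rule Ck_on_continuous[OF vC])
  have vtc: "continuous_on (cyl T) (dt T v)"
    by (intro Ck_on_continuous[where k = 0] Ck_on_dt le4) simp

  have dxv: "dx T i v z = dx T i us z - dx T i u z" if "z \<in> cyl T" for i z
    unfolding v_def by (rule dx_diff[OF T, where k = 0]) (use le4 that in auto)
  have wz: "w z = laplace T us z - laplace T u z" if "z \<in> cyl T" for z
    unfolding v_def w_def by (rule laplace_diff[OF T, where k = 0]) (use le4 that in auto)
  have dxw: "dx T i w z = dx T i (laplace T us) z - dx T i (laplace T u) z" if z: "z \<in> cyl T" for i z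
  proof -
    have "dx T i w z = dx T i (\<lambda>z. laplace T us z - laplace T u z) z"
      by (rule dx_cong[OF wz z])
    also have "\<dots> = dx T i (laplace T us) z - dx T i (laplace T u) z"
      by (rule dx_diff[OF T, where k = 0]) (use Ck_on_le[OF lusC, of 1] Ck_on_le[OF luC, of 1] z in auto)
    finally show ?thesis .
  qed
  have lapw: "laplace T w z = laplace T (laplace T us) z - laplace T (laplace T u) z" if z: "z \<in> cyl T" for z
  proof -
    have "laplace T w z = laplace T (\<lambda>z. laplace T us z - laplace T u z) z"
      by (rule laplace_cong[OF wz z])
    also have "\<dots> = laplace T (laplace T us) z - laplace T (laplace T u) z"
      by (rule laplace_diff[OF T, where k = 0]) (use lusC luC z in \<open>auto simp: numeral_2_eq_2\<close>)
    finally show ?thesis .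
  qed

  define E where "E t = integral cell (\<lambda>x. (norm (v (x, t)))\<^sup>2)" for t
  define H where "H t = 2 * integral cell (\<lambda>x. v (x, t) \<bullet> dt T v (x, t))" for t
  define IR where "IR t = integral cell (\<lambda>x. norm (R (x, t)))" for t
  define J1 where "J1 i t = jump_integral i (\<lambda>x. v (x, t))" for i t
  define J2 where "J2 i t = jump_integral i (\<lambda>x. dx T i v (x, t))" for i t
  define J3 where "J3 i t = jump_integral i (\<lambda>x. w (x, t))" for i t
  define J4 where "J4 i t = jump_integral i (\<lambda>x. dx T i w (x, t))" for i t
  define A where "A = 18 * d * (P\<^sup>2 + Q\<^sup>2) + 1/2 + 2 * lam\<^sup>2"
  define K where "K = b + 4 * a * b + 2 * (d * b)"
  define N where "N = sqrt (boundary_area TYPE('d)) * sqrt T"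
  define G where "G t = A * E t + (2 * b * IR t + K * (\<Sum>i\<in>UNIV. J1 i t + J2 i t + J3 i t + J4 i t))" for t

  have J1: "continuous_on {0..T} (J1 i)" "integral {0..T} (J1 i) \<le> N * L2_norm_boundary T (R_sb1 us)"
    and J2: "continuous_on {0..T} (J2 i)" "integral {0..T} (J2 i) \<le> N * L2_norm_boundary T (R_sb2 T us)"
    and J3: "continuous_on {0..T} (J3 i)" "integral {0..T} (J3 i) \<le> N * L2_norm_boundary T (R_sb3 T us)"
    and J4: "continuous_on {0..T} (J4 i)" "integral {0..T} (J4 i) \<le> N * L2_norm_boundary T (R_sb4 T us)" for i
  proof -
    note per = periodic[OF T uC uper]
    have up: "(upd i s x, t) \<in> cyl T" if "x \<in> cell" "t \<in> {0..T}" "s \<in> {0, 2}" for x t s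
      using that by (auto simp: mem_cyl intro!: upd_in_cell)
    have c: "continuous_on (cyl T) us" "continuous_on (cyl T) (dx T i us)"
      "continuous_on (cyl T) (laplace T us)" "continuous_on (cyl T) (dx T i (laplace T us))"
      "continuous_on (cyl T) (dx T i v)" "continuous_on (cyl T) w" "continuous_on (cyl T) (dx T i w)"
      using Ck_on_continuous[OF us] Ck_on_continuous[OF Ck_on_dx, OF le4(2)[of 1, unfolded One_nat_def]]
        Ck_on_continuous[OF lusC] Ck_on_continuous[OF Ck_on_dx, OF lusC[unfolded numeral_2_eq_2]]
        Ck_on_continuous[OF Ck_on_dx, OF le4(3)[of 1, unfolded One_nat_def]]
        Ck_on_continuous[OF wC] Ck_on_continuous[OF Ck_on_dx, OF wC[unfolded numeral_2_eq_2]] by auto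
    note bd = jump_integral_time_bound[OF T]
    show "continuous_on {0..T} (J1 i)" "integral {0..T} (J1 i) \<le> N * L2_norm_boundary T (R_sb1 us)"
      unfolding J1_def[abs_def] N_def
      by (rule bd[OF vc c(1)]; simp add: R_sb1_def v_def per)+
    show "continuous_on {0..T} (J2 i)" "integral {0..T} (J2 i) \<le> N * L2_norm_boundary T (R_sb2 T us)"
      unfolding J2_def[abs_def] N_def
      by (rule bd[OF c(5,2)]; simp add: R_sb2_def dn_2 dxv up per)+
    show "continuous_on {0..T} (J3 i)" "integral {0..T} (J3 i) \<le> N * L2_norm_boundary T (R_sb3 T us)"
      unfolding J3_def[abs_def] N_def
      by (rule bd[OF c(6,3)]; simp add: R_sb3_def wz up per)+
    show "continuous_on {0..T} (J4 i)" "integral {0..T} (J4 i) \<le> N * L2_norm_boundary T (R_sb4 T us)"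
      unfolding J4_def[abs_def] N_def
      by (rule bd[OF c(7,4)]; simp add: R_sb4_def dn_2 dxw up per)+
  qed
  have Ec: "continuous_on {0..T} E"
    unfolding E_def[abs_def] by (rule integral_cyl(2)) (intro continuous_intros vc)
  have IRc: "continuous_on {0..T} IR"
    unfolding IR_def[abs_def] by (rule integral_cyl(2)) (intro continuous_intros Rc)
  have Hc: "continuous_on {0..T} H"
    unfolding H_def[abs_def] by (rule continuous_on_mult_left, rule integral_cyl(2)) (intro continuous_intros vc vtc)
  note cont [continuous_intros] = J1(1) J2(1) J3(1) J4(1) Ec Hc IRc
  have Gc: "continuous_on {0..T} G" unfolding G_def[abs_def] by (intro continuous_intros)

  have HG_open: "H t \<le> G t" if t: "t \<in> {0<..<T}" for t
  proof -
    have t': "t \<in> {0..T}" using t by auto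
    have cyl: "(x, t) \<in> cyl T" if "x \<in> cell" for x :: "real^'d" using that t by (simp add: mem_cyl)
    have "2 * integral cell (\<lambda>x. v (x, t) \<bullet> dt T v (x, t)) \<le>
     (18 * real CARD('d) * (P\<^sup>2 + Q\<^sup>2) + 1/2 + 2 * lam\<^sup>2) * integral cell (\<lambda>x. (norm (v (x, t)))\<^sup>2)
     + 2 * b * integral cell (\<lambda>x. norm (R (x, t)))
     + (b + 4 * a * b + 2 * (d * b)) * (\<Sum>i\<in>UNIV. jump_integral i (\<lambda>x. v (x, t)) + jump_integral i (\<lambda>x. dx T i v (x, t))
          + jump_integral i (\<lambda>x. w (x, t)) + jump_integral i (\<lambda>x. dx T i w (x, t)))"
    \<comment> \<open>The parameter \<open>m\<close> becomes \<open>d * b\<close>, because the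
      Laplacian and its first derivatives are sums of d partial derivatives, each bounded by
      \<open>b\<close>.\<close>
    proof (rule energy_inequality[where u = "\<lambda>x. u (x, t)" and du = "\<lambda>i x. dx T i u (x, t)"
          and ddv = "\<lambda>i x. dx T i (dx T i v) (x, t)" and ddw = "\<lambda>i x. dx T i (dx T i w) (x, t)"])
      show "has_dx i (\<lambda>x. v (x, t)) (\<lambda>x. dx T i v (x, t))" for i
        by (rule has_dx_time_slice[OF le4(3)[of "Suc 0"] t']) simp
      show "has_dx i (\<lambda>x. dx T i v (x, t)) (\<lambda>x. dx T i (dx T i v) (x, t))" for i
        by (rule has_dx_time_slice[OF Ck_on_dx[OF le4(3)[of "Suc (Suc 0)"]] t']) simp
      show "has_dx i (\<lambda>x. w (x, t)) (\<lambda>x. dx T i w (x, t))" for i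
        by (rule has_dx_time_slice[OF wC[unfolded numeral_2_eq_2] t'])
      show "has_dx i (\<lambda>x. dx T i w (x, t)) (\<lambda>x. dx T i (dx T i w) (x, t))" for i
        by (rule has_dx_time_slice[OF Ck_on_dx[OF wC[unfolded numeral_2_eq_2]] t'])
      show "has_dx i (\<lambda>x. u (x, t)) (\<lambda>x. dx T i u (x, t))" for i
        by (rule has_dx_time_slice[OF le4(1)[of "Suc 0"] t']) simp
      show "continuous_on cell (\<lambda>x. R (x, t))" by (rule continuous_on_time_slice[OF Rc t'])
      show "b \<le> d * b" using mult_right_mono[OF d1 b0] by simp
      fix x :: "real^'d" and i assume x: "x \<in> cell"
      note z = cyl[OF x]
      show "w (x, t) = (\<Sum>i\<in>UNIV. dx T i (dx T i v) (x, t))" by (simp add: w_def laplace_def)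
      show "norm (v (x, t)) \<le> b" "norm (dx T i v (x, t)) \<le> b"
        unfolding b_def by (rule norm_le_Ck_norm[OF T vC z])+
      show "norm (w (x, t)) \<le> d * b" "norm (dx T i w (x, t)) \<le> d * b"
        unfolding b_def d_def w_def by (rule norm_laplace_le[OF T vC z])+
      show "norm (u (x, t)) \<le> a" unfolding a_def by (rule norm_le_Ck_norm[OF T uC z])
      show "norm (v (x, t)) \<le> P" "norm (u (x, t)) \<le> Q" by (rule P[OF z], rule Q[OF z])
      show "u (upd i 2 x, t) = u (upd i 0 x, t)" by (rule periodic[OF T uC uper x t'])
      have dtv: "dt T v (x, t) = dt T us (x, t) - dt T u (x, t)"
        unfolding v_def by (rule dt_diff[OF T, where k = 0]) (use le4 z in auto)
      have vz: "v (x, t) = us (x, t) - u (x, t)" by (simp add: v_def)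
      \<comment> \<open>Substituting us = u + v, the difference of the quadratic terms has exactly
        three parts besides the cancelled \<open>advect T u u\<close>.\<close>
      have adv: "advect T us us (x, t) - advect T u u (x, t) = (\<Sum>j\<in>UNIV. v (x, t) $ j *\<^sub>R dx T j v (x, t))
          + (\<Sum>j\<in>UNIV. u (x, t) $ j *\<^sub>R dx T j v (x, t)) + (\<Sum>j\<in>UNIV. v (x, t) $ j *\<^sub>R dx T j u (x, t))"
        unfolding advect_def sum.distrib[symmetric] sum_subtractf[symmetric]
        by (rule sum.cong) (simp_all add: dxv[OF z] vz algebra_simps)
      have "KS_operator lam T u (x, t) = 0" using uPDE[OF x] t by simp
      then have "R (x, t) = (dt T us (x, t) - dt T u (x, t)) + (advect T us us (x, t) - advect T u u (x, t))
          + lam *\<^sub>R (laplace T us (x, t) - laplace T u (x, t))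
          + (laplace T (laplace T us) (x, t) - laplace T (laplace T u) (x, t))"
        unfolding R_def R_PDE_def KS_operator_def by (simp add: algebra_simps)
      also have "\<dots> = dt T v (x, t) + (advect T us us (x, t) - advect T u u (x, t))
          + lam *\<^sub>R w (x, t) + laplace T w (x, t)"
        unfolding dtv wz[OF z] lapw[OF z] ..
      finally show "dt T v (x, t) = R (x, t) - (\<Sum>j\<in>UNIV. v (x, t) $ j *\<^sub>R dx T j v (x, t))
          - (\<Sum>j\<in>UNIV. u (x, t) $ j *\<^sub>R dx T j v (x, t)) - (\<Sum>j\<in>UNIV. v (x, t) $ j *\<^sub>R dx T j u (x, t))
          - lam *\<^sub>R w (x, t) - (\<Sum>i\<in>UNIV. dx T i (dx T i w) (x, t))"
        unfolding adv laplace_def[of T w] by simp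
    qed
    then show ?thesis
      unfolding H_def G_def A_def E_def IR_def K_def J1_def J2_def J3_def J4_def d_def by (simp add: algebra_simps)
  qed
  \<comment> \<open>The equation is available only in the open time interval; both sides are
    continuous in t, so the inequality extends to the endpoints.\<close>
  have HG: "H t \<le> G t" if t: "t \<in> {0..T}" for t
  proof -
    have cl: "closure {0<..<T} = {0..T}" using T by simp
    have "H t - G t \<le> 0"
      by (rule continuous_le_on_closure[where S = "{0<..<T}" and f = "\<lambda>t. H t - G t"])
        (use HG_open t in \<open>auto simp: cl intro!: continuous_intros Gc\<close>)
    then show ?thesis by simp
  qed

  define S where "S = L2_norm_boundary T (R_sb1 us) + L2_norm_boundary T (R_sb2 T us)
    + L2_norm_boundary T (R_sb3 T us) + L2_norm_boundary T (R_sb4 T us)"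
  define F where "F t = 2 * b * IR t + K * (\<Sum>i\<in>UNIV. J1 i t + J2 i t + J3 i t + J4 i t)" for t
  \<comment> \<open>Gronwall data: the initial energy plus all residual contributions, with boundary
    terms summed over the d directions.\<close>
  define \<beta> where "\<beta> = E 0 + 2 * b * (sqrt (2 ^ CARD('d)) * sqrt T * L2_norm (restrict_space lborel (cyl T)) R)
    + K * (d * (N * S))"
  have K0: "K \<ge> 0" unfolding K_def using a0 b0 d1 by simp
  have A0: "A \<ge> 0" unfolding A_def using d1 by simp
  have Fc: "continuous_on {0..T} F" unfolding F_def[abs_def] by (intro continuous_intros)
  have E0: "E t \<ge> 0" if "t \<in> {0..T}" for t
    unfolding E_def using continuous_on_time_slice[OF vc that]
    by (intro Henstock_Kurzweil_Integration.integral_nonneg integrable_cell continuous_intros) auto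
  have F0: "F t \<ge> 0" if "t \<in> {0..T}" for t
  proof -
    have "IR t \<ge> 0" unfolding IR_def using continuous_on_time_slice[OF Rc that]
      by (intro Henstock_Kurzweil_Integration.integral_nonneg integrable_cell continuous_intros) auto
    then show ?thesis
      unfolding F_def J1_def J2_def J3_def J4_def using K0 b0
      by (intro add_nonneg_nonneg mult_nonneg_nonneg sum_nonneg jump_integral_nonneg) auto
  qed
  have ireal: "f integrable_on {0..t}" if "continuous_on {0..T} f" "t \<in> {0..T}" for f :: "real \<Rightarrow> real" and t
    using that by (intro integrable_continuous_real) (auto elim!: continuous_on_subset)

  have intF: "integral {0..T} F \<le> 2 * b * (sqrt (2 ^ CARD('d)) * sqrt T * L2_norm (restrict_space lborel (cyl T)) R)
    + K * (d * (N * S))"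
  proof -
    have TT: "T \<in> {0..T}" using T by simp
    have nR: "continuous_on (cyl T) (\<lambda>z. norm (R z))" using Rc by (intro continuous_intros)
    have IRb: "integral {0..T} IR \<le> sqrt (2 ^ CARD('d)) * sqrt T * L2_norm (restrict_space lborel (cyl T)) R"
      unfolding IR_def[abs_def] integral_cyl(1)[OF nR] L2_norm_cyl(1)[OF Rc]
      using integral_le_sqrt[OF nR[unfolded cyl_cbox], folded cyl_cbox]
      by (simp add: content_cyl[OF T] real_sqrt_mult)
    have "integral {0..T} (\<lambda>t. J1 i t + J2 i t + J3 i t + J4 i t)
        = integral {0..T} (J1 i) + integral {0..T} (J2 i) + integral {0..T} (J3 i) + integral {0..T} (J4 i)" for i
      by (subst Henstock_Kurzweil_Integration.integral_add, (intro ireal continuous_intros TT)+)+ simp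
    then have Jb: "integral {0..T} (\<lambda>t. J1 i t + J2 i t + J3 i t + J4 i t) \<le> N * S" for i
      using J1(2)[of i] J2(2)[of i] J3(2)[of i] J4(2)[of i] by (simp add: S_def algebra_simps)
    have "integral {0..T} F = 2 * b * integral {0..T} IR
        + K * integral {0..T} (\<lambda>t. \<Sum>i\<in>UNIV. J1 i t + J2 i t + J3 i t + J4 i t)"
      unfolding F_def[abs_def]
      by (subst Henstock_Kurzweil_Integration.integral_add, (intro ireal continuous_intros TT)+) simp
    also have "integral {0..T} (\<lambda>t. \<Sum>i\<in>UNIV. J1 i t + J2 i t + J3 i t + J4 i t)
        = (\<Sum>i\<in>UNIV. integral {0..T} (\<lambda>t. J1 i t + J2 i t + J3 i t + J4 i t))"
      by (rule Henstock_Kurzweil_Integration.integral_sum) (auto intro!: ireal continuous_intros TT)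
    also have "2 * b * integral {0..T} IR + K * \<dots>
        \<le> 2 * b * (sqrt (2 ^ CARD('d)) * sqrt T * L2_norm (restrict_space lborel (cyl T)) R)
          + K * (\<Sum>i\<in>(UNIV::'d set). N * S)"
      using b0 K0 by (intro add_mono mult_left_mono sum_mono IRb Jb) auto
    finally show ?thesis by (simp add: d_def)
  qed
  have "E t \<le> \<beta> + A * integral {0..t} E" if t: "t \<in> {0..T}" for t
  proof -
    have "E t - E 0 = integral {0..t} H"
      unfolding E_def H_def[abs_def] by (rule energy_identity[OF le4(3)[of "Suc 0"] t]) simp
    also have "\<dots> \<le> integral {0..t} G"
      using HG t by (intro integral_le ireal Hc Gc) auto
    also have "\<dots> = integral {0..t} (\<lambda>s. A * E s) + integral {0..t} F"
      unfolding G_def[abs_def] F_def[symmetric]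
      by (rule Henstock_Kurzweil_Integration.integral_add; intro ireal continuous_intros Fc t)
    \<comment> \<open>\<open>F\<close> is nonnegative, so integrating up to T makes the additive
      term independent of t, as \<open>gronwall_integral\<close> requires.\<close>
    also have "integral {0..t} F \<le> integral {0..T} F"
      using F0 t T by (intro integral_subset_le ireal Fc) auto
    finally show ?thesis using intF by (simp add: \<beta>_def)
  qed
  moreover have "\<beta> \<ge> 0"
  proof -
    have "0 \<le> integral {0..T} F"
      using F0 T by (intro Henstock_Kurzweil_Integration.integral_nonneg ireal Fc) auto
    then show ?thesis using intF E0[of 0] T by (simp add: \<beta>_def)
  qed
  ultimately have "integral {0..T} E \<le> \<beta> * T * exp (A * T)"
    by (intro gronwall_integral Ec T A0)
  moreover have "(L2_norm (restrict_space lborel (cyl T)) v)\<^sup>2 = integral {0..T} E"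
    unfolding L2_norm_cyl(2)[OF vc] E_def[abs_def]
    by (rule integral_cyl(1)[symmetric]) (intro continuous_intros vc)
  moreover have "(L2_norm (restrict_space lborel cell) (R_tb us u))\<^sup>2 = E 0"
  proof -
    have "R_tb us u = (\<lambda>x. v (x, 0))" by (simp add: R_tb_def[abs_def] v_def)
    then show ?thesis
      unfolding E_def using T by (simp add: L2_norm_cell continuous_on_time_slice[OF vc])
  qed
  ultimately show "(L2_norm (restrict_space lborel (cyl T)) v)\<^sup>2 \<le>
    ((L2_norm (restrict_space lborel cell) (R_tb us u))\<^sup>2
      + 2 * b * (sqrt (2 ^ CARD('d)) * sqrt T * L2_norm (restrict_space lborel (cyl T)) (R_PDE lam T us))
      + (b + 4 * a * b + 2 * (d * b)) * (d * (sqrt (boundary_area TYPE('d)) * sqrt T *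
          (L2_norm_boundary T (R_sb1 us) + L2_norm_boundary T (R_sb2 T us)
           + L2_norm_boundary T (R_sb3 T us) + L2_norm_boundary T (R_sb4 T us)))))
    * T * exp ((18 * d * (P\<^sup>2 + Q\<^sup>2) + 1/2 + 2 * lam\<^sup>2) * T)"
    unfolding \<beta>_def A_def K_def N_def S_def R_def by simp
qed

section \<open>Choice of the constants\<close>

lemma L2_norm_nonneg: "L2_norm M f \<ge> 0"
  by (simp add: L2_norm_def)

lemma L2_norm_boundary_nonneg: "L2_norm_boundary T g \<ge> 0"
  unfolding L2_norm_boundary_def by (intro real_sqrt_ge_zero sum_nonneg) auto

lemma sqrt_le_exp: "T \<ge> 0 \<Longrightarrow> sqrt T \<le> exp T"
proof -
  assume "T \<ge> 0"
  have "sqrt T \<le> 1 + T"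
    by (rule real_le_lsqrt) (use \<open>T \<ge> 0\<close> in \<open>auto simp: power2_eq_square algebra_simps\<close>)
  then show ?thesis using exp_ge_add_one_self[of T] by linarith
qed

theorem theorem3p13:
  fixes lam :: real
  assumes dim: "CARD('d::finite) \<in> {2, 3}"
    and lam: "lam > 0"
  shows "\<exists>C1 > 0. \<exists>C :: real \<Rightarrow> real \<Rightarrow> real. (\<forall>a b. C a b > 0) \<and>
    (\<forall>T > 0. \<forall>(u :: 'd field) (ustar :: 'd field) \<sigma>.
       KS_solution lam T u \<longrightarrow>
       neural_network \<sigma> (cyl T) ustar \<longrightarrow>
       Ck_on 4 (cyl T) ustar \<longrightarrow>
       (let D = restrict_space lborel cell;
            \<Omega> = restrict_space lborel (cyl T);
            uhat = (\<lambda>z. ustar z - u z);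
            C2 = C1 * ((SUP t\<in>{0..T}. Linf_norm D (\<lambda>x. uhat (x, t)))\<^sup>2
                     + (SUP t\<in>{0..T}. Linf_norm D (\<lambda>x. u (x, t)))\<^sup>2
                     + (SUP t\<in>{0..T}. L2_norm D (\<lambda>x. grad T u (x, t)))\<^sup>2 + 1);
            K = C (Ck_norm 4 (cyl T) u) (Ck_norm 4 (cyl T) uhat);
            C3 = (L2_norm D (R_tb ustar u))\<^sup>2
               + K * L2_norm \<Omega> (R_PDE lam T ustar)
               + K * sqrt (boundary_area TYPE('d)) * sqrt T *
                   (L2_norm_boundary T (R_sb1 ustar) + L2_norm_boundary T (R_sb2 T ustar)
                  + L2_norm_boundary T (R_sb3 T ustar) + L2_norm_boundary T (R_sb4 T ustar))
        in (L2_norm \<Omega> uhat)\<^sup>2 \<le> C3 * (T + C2 * T\<^sup>2 * exp (C2 * T))))"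
proof -
  define d where "d = real CARD('d)"
  \<comment> \<open>Chosen so that \<open>A + 1 \<le> C2\<close> below: 18d covers the factor of P^2
    + Q^2, and 2 + 2 lam^2 covers the constant part 3/2 + 2 lam^2. It depends only on d and
    \<open>lam\<close>.\<close>
  define C1 where "C1 = 18 * d + 2 + 2 * lam\<^sup>2"
  \<comment> \<open>The sum of the coefficients of the PDE residual (without its sqrt T) and of the
    boundary residuals. Absolute values and the final 1 make it positive for all real arguments; at
    actual norms the absolute values disappear.\<close>
  define C where "C a b = 2 * \<bar>b\<bar> * sqrt (2 ^ CARD('d)) + (\<bar>b\<bar> + 4 * \<bar>a\<bar> * \<bar>b\<bar> + 2 * (d * \<bar>b\<bar>)) * d + 1" for a b :: real
  have d0: "d \<ge> 0" by (simp add: d_def)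
  have C1: "C1 > 0" using d0 by (simp add: C1_def add_nonneg_pos add_pos_nonneg)
  have C: "C a b > 0" for a b
    unfolding C_def using d0 by (intro add_nonneg_pos add_nonneg_nonneg mult_nonneg_nonneg) auto
  \<comment> \<open>The \<open>let\<close>-bound quantities are variables with defining equations
    here, which the last step of the proof closes by reflexivity.\<close>
  have main: "(L2_norm (restrict_space lborel (cyl T)) (\<lambda>z. ustar z - u z))\<^sup>2
      \<le> (X + Kc * Y + Kc * sqrt (boundary_area TYPE('d)) * sqrt T * Z) * (T + C2 * T\<^sup>2 * exp (C2 * T))"
    if T: "T > 0" and u: "KS_solution lam T u" and us: "Ck_on 4 (cyl T) ustar"
      and C2: "C2 = C1 * ((SUP t\<in>{0..T}. Linf_norm (restrict_space lborel cell) (\<lambda>x. ustar (x, t) - u (x, t)))\<^sup>2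
         + (SUP t\<in>{0..T}. Linf_norm (restrict_space lborel cell) (\<lambda>x. u (x, t)))\<^sup>2 + Gr\<^sup>2 + 1)"
      and Kc: "Kc = C (Ck_norm 4 (cyl T) u) (Ck_norm 4 (cyl T) (\<lambda>z. ustar z - u z))"
      and X: "X = (L2_norm (restrict_space lborel cell) (R_tb ustar u))\<^sup>2"
      and Y: "Y = L2_norm (restrict_space lborel (cyl T)) (R_PDE lam T ustar)"
      and Z: "Z = L2_norm_boundary T (R_sb1 ustar) + L2_norm_boundary T (R_sb2 T ustar)
                  + L2_norm_boundary T (R_sb3 T ustar) + L2_norm_boundary T (R_sb4 T ustar)"
    for T and u ustar :: "'d field" and C2 Gr Kc X Y Z
  proof -
    define a where "a = Ck_norm 4 (cyl T) u"
    define b where "b = Ck_norm 4 (cyl T) (\<lambda>z. ustar z - u z)"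
    define P where "P = (SUP t\<in>{0..T}. Linf_norm (restrict_space lborel cell) (\<lambda>x. ustar (x, t) - u (x, t)))"
    define Q where "Q = (SUP t\<in>{0..T}. Linf_norm (restrict_space lborel cell) (\<lambda>x. u (x, t)))"
    define A where "A = 18 * d * (P\<^sup>2 + Q\<^sup>2) + 1/2 + 2 * lam\<^sup>2"
    define q where "q = sqrt (2 ^ CARD('d))"
    define N where "N = sqrt (boundary_area TYPE('d)) * sqrt T"
    define M where "M = (b + 4 * a * b + 2 * (d * b)) * d"
    define C3 where "C3 = X + Kc * Y + Kc * N * Z"
    have uC: "Ck_on 4 (cyl T) u" using u by (simp add: KS_solution_def)
    have c: "continuous_on (cyl T) (\<lambda>z. ustar z - u z)" "continuous_on (cyl T) u"
      using Ck_on_continuous[OF us] Ck_on_continuous[OF uC] by (auto intro: continuous_on_diff)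
    have P: "norm (ustar z - u z) \<le> P" and Q: "norm (u z) \<le> Q" if "z \<in> cyl T" for z
      using norm_le_SUP_Linf[OF c(1), of "fst z" "snd z"] norm_le_SUP_Linf[OF c(2), of "fst z" "snd z"] that
      by (simp_all add: P_def Q_def)
    note est = energy_estimate[OF T u us P Q, folded a_def b_def d_def X Y Z q_def N_def, folded A_def]
    have ab: "a \<ge> 0" "b \<ge> 0" using est(2,3) by auto
    have X0: "X \<ge> 0" and Y0: "Y \<ge> 0" and Z0: "Z \<ge> 0" and N0: "N \<ge> 0" and q0: "q \<ge> 0"
      using T by (auto simp: X Y Z N_def q_def boundary_area_eq L2_norm_nonneg intro!: add_nonneg_nonneg L2_norm_boundary_nonneg)
    have Kc': "Kc = 2 * b * q + M + 1"
      unfolding Kc C_def a_def[symmetric] b_def[symmetric] q_def M_def using ab by simp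
    have M0: "M \<ge> 0" unfolding M_def using ab d0 by simp
    have K1: "2 * b * q \<le> Kc" "M \<le> Kc" "Kc \<ge> 0" unfolding Kc' using M0 ab q0 by auto
    have C30: "C3 \<ge> 0" unfolding C3_def using X0 Y0 Z0 N0 K1 by simp
    text \<open>
      The Cauchy-Schwarz inequality produces a factor \<open>sqrt T\<close> in front of the PDE residual; as the
      constant \<open>K\<close> may not depend on \<open>T\<close>, it is absorbed into the exponential by \<open>A + 1 \<le> C\<^sub>2\<close>.
    \<close>
    have e1: "exp T \<ge> 1" using T by simp
    have C2A: "A + 1 \<le> C2"
    proof -
      have "A + 1 \<le> C1 * (P\<^sup>2 + Q\<^sup>2) + C1"
        unfolding A_def C1_def using d0 by (simp add: algebra_simps)
      also have "\<dots> \<le> C1 * (P\<^sup>2 + Q\<^sup>2 + Gr\<^sup>2 + 1)" using C1 by (simp add: algebra_simps)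
      finally show ?thesis unfolding C2 P_def Q_def .
    qed
    have "X + 2 * b * (q * sqrt T * Y) + (b + 4 * a * b + 2 * (d * b)) * (d * (N * Z))
        = X * 1 + 2 * b * q * Y * sqrt T + M * N * Z * 1"
      by (simp add: M_def algebra_simps)
    also have "\<dots> \<le> X * exp T + Kc * Y * exp T + Kc * N * Z * exp T"
      by (intro add_mono mult_mono mult_left_mono mult_right_mono)
        (use X0 Y0 Z0 N0 q0 ab K1 M0 e1 T sqrt_le_exp[of T] in auto)
    also have "\<dots> = C3 * exp T" by (simp add: C3_def algebra_simps)
    finally have \<beta>: "X + 2 * b * (q * sqrt T * Y) + (b + 4 * a * b + 2 * (d * b)) * (d * (N * Z)) \<le> C3 * exp T" .
    have "(L2_norm (restrict_space lborel (cyl T)) (\<lambda>z. ustar z - u z))\<^sup>2 \<le> C3 * exp T * T * exp (A * T)"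
      using T by (intro order_trans[OF est(1)] mult_right_mono \<beta>) auto
    also have "\<dots> = C3 * (T * exp ((A + 1) * T))" by (simp add: algebra_simps exp_add)
    also have "\<dots> \<le> C3 * (T * exp (C2 * T))"
      using C2A T C30 by (intro mult_left_mono) auto
    also have "\<dots> \<le> C3 * (T * (1 + C2 * T * exp (C2 * T)))"
      using exp_le_one_plus_mult_exp[of "C2 * T"] T C30 by (intro mult_left_mono) auto
    also have "\<dots> = C3 * (T + C2 * T\<^sup>2 * exp (C2 * T))" by (simp add: algebra_simps power2_eq_square)
    finally show ?thesis by (simp add: C3_def N_def mult.assoc)
  qed
  show ?thesis
    unfolding Let_def
    by (intro exI[of _ C1] exI[of _ C] conjI C1 allI C impI main) (assumption | rule refl)+
qed

end
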